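(* Assume that $\bar A_k$ is invertible for every $k\in[\![0,N-1]\!]$, and that $\{\Pi_k\}_{k=0}^N$ and $\{H_k\}_{k=0}^N$ in $\mathcal S^n$ satisfy, for $k\in[\![0,N-1]\!]$, the Riccati equations $$\Pi_k=\bar A_k^\top\Pi_{k+1}\bar A_k-\bar A_k^\top\Pi_{k+1}B_k(I+B_k^\top\Pi_{k+1}B_k)^{-1}B_k^\top\Pi_{k+1}\bar A_k+\bar Q_k,$$ $$H_k=\bar A_k^\top H_{k+1}\bar A_k-\bar A_k^\top H_{k+1}B_k(-I+B_k^\top H_{k+1}B_k)^{-1}B_k^\top H_{k+1}\bar A_k-\bar Q_k,$$ with the boundary conditions $\bar\Sigma_0^{-1}=\Pi_0+H_0$ and $\bar\Sigma_N^{-1}=\Pi_N+H_N$. Assume further that $I+B_k^\top\Pi_{k+1}B_k\succ0$ for every $k\in[\![0,N-1]\!]$. Then the policy $$\pi_k^*(u|h_k)=\mathcal N\bigl(u\,\big|\,-(I+B_k^\top\Pi_{k+1}B_k)^{-1}(B_k^\top\Pi_{k+1}A_k+S_k^\top)x_k,\ (I+B_k^\top\Pi_{k+1}B_k)^{-1}\bigr),\quad k\in[\![0,N-1]\!],$$ is the unique optimal policy of the MaxEnt density control problem (with $R_k\equiv I$, $\varepsilon=1$) described in the context.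
   Context: Notation: $n,m,N$ are positive integers; $[\![k,l]\!]=\{k,k+1,\dots,l\}$; $\mathcal S^n$ is the set of real symmetric $n\times n$ matrices; $\succ,\succeq$ denote the positive (semi)definite order; $\mathcal N(\cdot|\mu,\Sigma)$ is the Gaussian density with mean $\mu$ and covariance $\Sigma\succ0$. Data: for $k\in[\![0,N-1]\!]$, $A_k\in\mathbb R^{n\times n}$, $B_k\in\mathbb R^{n\times m}$, $S_k\in\mathbb R^{n\times m}$, $Q_k\in\mathcal S^n$; $\bar A_k:=A_k-B_kS_k^\top$, $\bar Q_k:=Q_k-S_kS_k^\top$, with $\bar Q_k\succeq0$; $\bar\Sigma_0,\bar\Sigma_N\in\mathcal S^n$ are positive definite. A solution of a Riccati equation is understood to be such that the inverse appearing in it exists at every step. MaxEnt density control problem ($R_k\equiv I$, $\varepsilon=1$): find a policy $\pi=\{\pi_k\}_{k=0}^{N-1}$ minimizing $$\mathbb E\Bigl[\sum_{k=0}^{N-1}\Bigl(\tfrac12\begin{bmatrix}x_k\\ u_k\end{bmatrix}^\top\begin{bmatrix}Q_k&S_k\\ S_k^\top&I\end{bmatrix}\begin{bmatrix}x_k\\ u_k\end{bmatrix}-\mathcal H(\pi_k(\cdot|h_k))\Bigr)\Bigr]$$ subject to $x_{k+1}=A_kx_k+B_ku_k$, $u_k\sim\pi_k(\cdot|h_k)$ given the history $h_k=\{x_0,u_0,\dots,x_{k-1},u_{k-1},x_k\}$ ($k=0,\dots,N-1$), and $x_0\sim\mathcal N(0,\bar\Sigma_0)$, $x_N\sim\mathcal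 N(0,\bar\Sigma_N)$. Here $\pi_k(\cdot|h_k)$ is the conditional density of $u_k$ given $h_k$ (as such determined only up to null sets), and $\mathcal H(\pi_k(\cdot|h_k))=-\int_{\mathbb R^m}\pi_k(u|h_k)\log\pi_k(u|h_k)\,du$. *)

theory Defs
  imports "HOL-Probability.Probability"
begin

subsection \<open>Matrices and Gaussian densities\<close>

definition symmetric_mat :: "real^'n^'n \<Rightarrow> bool" where
  "symmetric_mat M \<longleftrightarrow> transpose M = M"

definition pos_semidef :: "real^'n^'n \<Rightarrow> bool" where
  "pos_semidef M \<longleftrightarrow> symmetric_mat M \<and> (\<forall>v. 0 \<le> v \<bullet> (M *v v))"

definition pos_def :: "real^'n^'n \<Rightarrow> bool" where
  "pos_def M \<longleftrightarrow> symmetric_mat M \<and> (\<forall>v. v \<noteq> 0 \<longrightarrow> 0 < v \<bullet> (M *v v))"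

definition gaussian_density :: "real^'n \<Rightarrow> real^'n^'n \<Rightarrow> real^'n \<Rightarrow> real" where
  "gaussian_density \<mu> V x =
     exp (- ((x - \<mu>) \<bullet> (matrix_inv V *v (x - \<mu>))) / 2) / sqrt ((2 * pi) ^ CARD('n) * det V)"

definition diff_entropy :: "(real^'m \<Rightarrow> real) \<Rightarrow> real" where
  "diff_entropy p = - (\<integral>u. p u * ln (p u) \<partial>lborel)"


subsection \<open>Riccati equations\<close>

definition A_bar ::
    "(nat \<Rightarrow> real^'n^'n) \<Rightarrow> (nat \<Rightarrow> real^'m^'n) \<Rightarrow> (nat \<Rightarrow> real^'m^'n) \<Rightarrow> nat \<Rightarrow> real^'n^'n" where
  "A_bar A B S k = A k - B k ** transpose (S k)"

definition Q_bar :: "(nat \<Rightarrow> real^'n^'n) \<Rightarrow> (nat \<Rightarrow> real^'m^'n) \<Rightarrow> nat \<Rightarrow> real^'n^'n" where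
  "Q_bar Q S k = Q k - S k ** transpose (S k)"

text \<open>
  The library inverse \<^const>\<open>matrix_inv\<close> is unspecified on singular matrices, so the existence
  of the inverse is part of being a solution.
\<close>

definition riccati_solution ::
    "nat \<Rightarrow> (nat \<Rightarrow> real^'n^'n) \<Rightarrow> (nat \<Rightarrow> real^'m^'n) \<Rightarrow> real^'m^'m \<Rightarrow> (nat \<Rightarrow> real^'n^'n) \<Rightarrow>
     (nat \<Rightarrow> real^'n^'n) \<Rightarrow> bool" where
  "riccati_solution N F B R W P \<longleftrightarrow>
     (\<forall>k\<le>N. symmetric_mat (P k)) \<and>
     (\<forall>k<N. invertible (R + transpose (B k) ** P (Suc k) ** B k) \<and>
        P k = transpose (F k) ** P (Suc k) ** F k
              - transpose (F k) ** P (Suc k) ** B k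
                ** matrix_inv (R + transpose (B k) ** P (Suc k) ** B k)
                ** transpose (B k) ** P (Suc k) ** F k
              + W k)"


subsection \<open>Policies and the controlled process\<close>

text \<open>
  A history \<open>h\<^sub>k = (x\<^sub>0, u\<^sub>0, \<dots>, x\<^bsub>k-1\<^esub>, u\<^bsub>k-1\<^esub>, x\<^sub>k)\<close> is a pair of extensional families, the states
  indexed by \<open>{..k}\<close> and the controls by \<open>{..<k}\<close>.  A history at the horizon \<open>N\<close> is a full
  trajectory.
\<close>

type_synonym ('n, 'm) history = "(nat \<Rightarrow> real^'n) \<times> (nat \<Rightarrow> real^'m)"

type_synonym ('n, 'm) policy = "nat \<Rightarrow> ('n, 'm) history \<Rightarrow> real^'m \<Rightarrow> real"

definition hist_space :: "nat \<Rightarrow> ('n::finite, 'm::finite) history measure" where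
  "hist_space k = PiM {..k} (\<lambda>_. borel) \<Otimes>\<^sub>M PiM {..<k} (\<lambda>_. borel)"

definition hist_at :: "nat \<Rightarrow> ('n::finite, 'm::finite) history \<Rightarrow> ('n, 'm) history" where
  "hist_at k h = (restrict (fst h) {..k}, restrict (snd h) {..<k})"

definition is_policy :: "nat \<Rightarrow> ('n::finite, 'm::finite) policy \<Rightarrow> bool" where
  "is_policy N \<pi> \<longleftrightarrow>
     (\<forall>k<N. (\<lambda>(h, u). \<pi> k h u) \<in> borel_measurable (hist_space k \<Otimes>\<^sub>M borel) \<and>
        (\<forall>h\<in>space (hist_space k). (\<forall>u. 0 \<le> \<pi> k h u) \<and> (\<integral>\<^sup>+u. ennreal (\<pi> k h u) \<partial>lborel) = 1))"

definition extend_hist ::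
    "(nat \<Rightarrow> real^'n^'n) \<Rightarrow> (nat \<Rightarrow> real^'m^'n) \<Rightarrow> nat \<Rightarrow> ('n::finite, 'm::finite) history \<Rightarrow> real^'m
     \<Rightarrow> ('n, 'm) history" where
  "extend_hist A B k h u =
     ((fst h)(Suc k := A k *v fst h k + B k *v u), (snd h)(k := u))"

text \<open>
  The law of \<open>h\<^sub>k\<close> when \<open>x\<^sub>0\<close> is centred Gaussian with covariance \<open>V0\<close>, each \<open>u\<^sub>j\<close> has conditional
  density \<open>\<pi> j h\<^sub>j\<close> given \<open>h\<^sub>j\<close>, and \<open>x\<^bsub>j+1\<^esub> = A\<^sub>j x\<^sub>j + B\<^sub>j u\<^sub>j\<close>.
\<close>

primrec hist_law ::
    "(nat \<Rightarrow> real^'n^'n) \<Rightarrow> (nat \<Rightarrow> real^'m^'n) \<Rightarrow> real^'n^'n \<Rightarrow> ('n::finite, 'm::finite) policy \<Rightarrow> nat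
     \<Rightarrow> ('n, 'm) history measure" where
  "hist_law A B V0 \<pi> 0 =
     distr (density lborel (\<lambda>x. ennreal (gaussian_density 0 V0 x))) (hist_space 0)
       (\<lambda>x. (restrict (\<lambda>_. x) {..0}, restrict (\<lambda>_. 0) {..<0}))"
| "hist_law A B V0 \<pi> (Suc k) =
     hist_law A B V0 \<pi> k \<bind>
       (\<lambda>h. distr (density lborel (\<lambda>u. ennreal (\<pi> k h u))) (hist_space (Suc k)) (extend_hist A B k h))"


subsection \<open>The maximum entropy density control problem\<close>

text \<open>The quadratic form of the block matrix with rows \<open>(Q, S)\<close> and \<open>(S\<^sup>T, I)\<close>, multiplied out.\<close>

definition stage_cost ::
    "real^'n^'n \<Rightarrow> real^'m^'n \<Rightarrow> real^'n \<Rightarrow> real^'m \<Rightarrow> real" where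
  "stage_cost Q S x u =
     (x \<bullet> (Q *v x) + x \<bullet> (S *v u) + u \<bullet> (transpose S *v x) + u \<bullet> u) / 2"

definition path_cost ::
    "nat \<Rightarrow> (nat \<Rightarrow> real^'n^'n) \<Rightarrow> (nat \<Rightarrow> real^'m^'n) \<Rightarrow> ('n::finite, 'm::finite) policy
     \<Rightarrow> ('n, 'm) history \<Rightarrow> real" where
  "path_cost N Q S \<pi> h =
     (\<Sum>k<N. stage_cost (Q k) (S k) (fst h k) (snd h k) - diff_entropy (\<pi> k (hist_at k h)))"

definition maxent_cost ::
    "nat \<Rightarrow> (nat \<Rightarrow> real^'n^'n) \<Rightarrow> (nat \<Rightarrow> real^'m^'n) \<Rightarrow> (nat \<Rightarrow> real^'n^'n) \<Rightarrow> (nat \<Rightarrow> real^'m^'n)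
     \<Rightarrow> real^'n^'n \<Rightarrow> ('n::finite, 'm::finite) policy \<Rightarrow> real" where
  "maxent_cost N A B Q S V0 \<pi> = (\<integral>h. path_cost N Q S \<pi> h \<partial>hist_law A B V0 \<pi> N)"

text \<open>
  The Bochner integral is \<open>0\<close> for non-integrable functions.  Hence the integrability conditions:
  they say that the entropies and the expectation in the objective exist and are finite.
\<close>

definition maxent_feasible ::
    "nat \<Rightarrow> (nat \<Rightarrow> real^'n^'n) \<Rightarrow> (nat \<Rightarrow> real^'m^'n) \<Rightarrow> (nat \<Rightarrow> real^'n^'n) \<Rightarrow> (nat \<Rightarrow> real^'m^'n)
     \<Rightarrow> real^'n^'n \<Rightarrow> real^'n^'n \<Rightarrow> ('n::finite, 'm::finite) policy \<Rightarrow> bool" where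
  "maxent_feasible N A B Q S V0 VN \<pi> \<longleftrightarrow>
     is_policy N \<pi> \<and>
     (\<forall>k<N. AE h in hist_law A B V0 \<pi> k. integrable lborel (\<lambda>u. \<pi> k h u * ln (\<pi> k h u))) \<and>
     integrable (hist_law A B V0 \<pi> N) (path_cost N Q S \<pi>) \<and>
     distributed (hist_law A B V0 \<pi> N) lborel (\<lambda>h. fst h N) (\<lambda>x. ennreal (gaussian_density 0 VN x))"

definition maxent_optimal ::
    "nat \<Rightarrow> (nat \<Rightarrow> real^'n^'n) \<Rightarrow> (nat \<Rightarrow> real^'m^'n) \<Rightarrow> (nat \<Rightarrow> real^'n^'n) \<Rightarrow> (nat \<Rightarrow> real^'m^'n)
     \<Rightarrow> real^'n^'n \<Rightarrow> real^'n^'n \<Rightarrow> ('n::finite, 'm::finite) policy \<Rightarrow> bool" where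
  "maxent_optimal N A B Q S V0 VN \<pi> \<longleftrightarrow>
     maxent_feasible N A B Q S V0 VN \<pi> \<and>
     (\<forall>\<pi>'. maxent_feasible N A B Q S V0 VN \<pi>' \<longrightarrow>
        maxent_cost N A B Q S V0 \<pi> \<le> maxent_cost N A B Q S V0 \<pi>')"

text \<open>
  Equality of policies as families of conditional densities.  The null sets of histories are those
  of the law of \<open>h\<^sub>k\<close>, not Lebesgue null sets: this law is concentrated on the histories that obey
  the dynamics.  The relation is symmetric on policies, as by induction on \<open>k\<close> related policies
  have the same history laws.
\<close>

definition same_policy ::
    "nat \<Rightarrow> (nat \<Rightarrow> real^'n^'n) \<Rightarrow> (nat \<Rightarrow> real^'m^'n) \<Rightarrow> real^'n^'n
     \<Rightarrow> ('n::finite, 'm::finite) policy \<Rightarrow> ('n, 'm) policy \<Rightarrow> bool" where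
  "same_policy N A B V0 \<pi> \<pi>' \<longleftrightarrow>
     (\<forall>k<N. AE h in hist_law A B V0 \<pi> k. AE u in lborel. \<pi> k h u = \<pi>' k h u)"

definition riccati_policy ::
    "(nat \<Rightarrow> real^'n^'n) \<Rightarrow> (nat \<Rightarrow> real^'m^'n) \<Rightarrow> (nat \<Rightarrow> real^'m^'n) \<Rightarrow> (nat \<Rightarrow> real^'n^'n)
     \<Rightarrow> ('n::finite, 'm::finite) policy" where
  "riccati_policy A B S P k h =
     (let G = matrix_inv (mat 1 + transpose (B k) ** P (Suc k) ** B k)
      in gaussian_density
           (- ((G ** (transpose (B k) ** P (Suc k) ** A k + transpose (S k))) *v fst h k)) G)"

end

theory Submission
  imports Defs
begin

text \<open>
  The Riccati equation for \<open>P\<close> completes the stage cost to a square. With \<open>V\<^sub>k(x) = x \<bullet> (P k *v x) / 2\<close> and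
  \<open>\<pi>*\<close> the Gaussian policy of the theorem, it says
  \<open>cost\<^sub>k(x\<^sub>k, u\<^sub>k) = V\<^sub>k(x\<^sub>k) - V\<^bsub>k+1\<^esub>(x\<^bsub>k+1\<^esub>) - ln \<pi>*\<^sub>k(u\<^sub>k | h\<^sub>k) - const\<^sub>k\<close>, because the square is that of the
  deviation of the control from its mean under \<open>\<pi>*\<close>, weighted by the inverse covariance
  (\<open>stage_cost_completion\<close>, \<open>stage_cost_opt\<close>). Along a trajectory the value functions telescope. Hence the
  objective of a policy \<open>\<pi>\<close> is the expectation of \<open>V\<^sub>0(x\<^sub>0) - V\<^sub>N(x\<^sub>N)\<close>, which the prescribed marginals fix,
  minus a constant, plus the expectation of the sum of \<open>- ln \<pi>*\<^sub>k(u\<^sub>k | h\<^sub>k) - H(\<pi>\<^sub>k( . | h\<^sub>k))\<close>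
  (\<open>cost_eq_excess\<close>). Given \<open>h\<^sub>k\<close>, such a summand has as its mean the Kullback-Leibler divergence of
  \<open>\<pi>\<^sub>k( . | h\<^sub>k)\<close> from \<open>\<pi>*\<^sub>k( . | h\<^sub>k)\<close>, which is nonnegative and is zero only if the two densities agree almost
  everywhere. This gives both optimality and uniqueness.

  For an arbitrary feasible policy the single summands may fail to be integrable even though their sum is
  integrable. The theorem \<open>sequential_gibbs\<close> deals with this by integrating out the controls one at a time,
  from the last to the first.

  It remains to see that \<open>\<pi>*\<close> is feasible, which is where \<open>H\<close> enters. Under \<open>\<pi>*\<close> the state is a centred
  Gaussian whose covariance follows the closed loop recursion. By \<open>closed_loop_covariance\<close> the inverse of
  \<open>P k + H k\<close> follows the same recursion; the two agree at time \<open>0\<close> by the first boundary condition, hence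
  also at time \<open>N\<close>, where the second one identifies the terminal law (\<open>opt_state_law\<close>). That an affine image of
  independent Gaussian vectors is Gaussian is shown on densities (\<open>nn_integral_gaussian_affine\<close>), starting from
  the linear change of variables formula (\<open>nn_integral_lborel_linear\<close>) and a factorisation of positive
  definite matrices (\<open>pos_def_factor\<close>).
\<close>

section \<open>Matrix arithmetic\<close>

lemma inner_matrix_vector_left:
  fixes M :: "real^'m^'n"
  shows "(M *v x) \<bullet> y = x \<bullet> (transpose M *v y)"
  by (metis dot_lmul_matrix inner_commute transpose_matrix_vector transpose_transpose)

lemma matrix_inv_eqI:
  fixes M :: "real^'n^'n"
  assumes "M ** K = mat 1"
  shows "matrix_inv M = K"
proof -
  have "invertible M" using assms invertible_right_inverse by blast
  then have "matrix_inv M ** M = mat 1"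
    unfolding invertible_def matrix_inv_def by (metis (mono_tags, lifting) someI_ex)
  then show ?thesis using assms by (metis matrix_mul_assoc matrix_mul_lid matrix_mul_rid)
qed

lemma matrix_inv_inverse:
  fixes M :: "real^'n^'n"
  assumes "invertible M"
  shows "M ** matrix_inv M = mat 1" "matrix_inv M ** M = mat 1"
  using assms unfolding invertible_def matrix_inv_def by (metis (mono_tags, lifting) someI_ex)+

lemma invertible_transpose:
  "invertible (M::real^'n^'n) \<Longrightarrow> invertible (transpose M)"
  by (simp add: invertible_det_nz)

lemma matrix_inv_matrix_inv:
  fixes M :: "real^'n^'n"
  shows "invertible M \<Longrightarrow> matrix_inv (matrix_inv M) = M"
  using matrix_inv_inverse[of M] by (auto intro: matrix_inv_eqI)

lemma matrix_diff_ldistrib: "(X::real^'m^'n) ** (Y - Z) = X ** Y - X ** Z"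
  by (simp add: matrix_matrix_mult_def vec_eq_iff algebra_simps sum_subtractf)

lemma matrix_diff_rdistrib: "((Y::real^'m^'n) - Z) ** X = Y ** X - Z ** X"
  by (simp add: matrix_matrix_mult_def vec_eq_iff algebra_simps sum_subtractf)

lemma matrix_add_rdistrib: "((Y::real^'m^'n) + Z) ** X = Y ** X + Z ** X"
  by (simp add: matrix_matrix_mult_def vec_eq_iff algebra_simps sum.distrib)

lemma transpose_add: "transpose (X + Y) = transpose X + transpose (Y::real^'m^'n)"
  by (simp add: transpose_def vec_eq_iff)

lemma transpose_diff: "transpose (X - Y) = transpose X - transpose (Y::real^'m^'n)"
  by (simp add: transpose_def vec_eq_iff)

lemma symmetric_mat_inner:
  "symmetric_mat K \<Longrightarrow> a \<bullet> (K *v b) = b \<bullet> (K *v a)"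
  using inner_matrix_vector_left[of K b a] by (simp add: symmetric_mat_def inner_commute)

section \<open>Positive definite matrices\<close>

text \<open>
  Gram-Schmidt for the inner product \<open>(v, w) \<mapsto> v \<bullet> (M *v w)\<close>: as long as \<open>k\<close> is below the dimension
  some vector lies outside the span of the first \<open>k\<close>, and its component orthogonal to them can be
  normalised.
\<close>
lemma vector_orthonormal_wrt_pos_def:
  fixes M :: "real^'n^'n"
  assumes M: "pos_def M"
  shows "k \<le> CARD('n) \<Longrightarrow> \<exists>v::nat \<Rightarrow> real^'n. \<forall>i<k. \<forall>j<k. v i \<bullet> (M *v v j) = of_bool (i = j)"
proof (induction k)
  case 0
  then show ?case by simp
next
  case (Suc k)
  then obtain v :: "nat \<Rightarrow> real^'n"
    where v: "\<And>i j. i < k \<Longrightarrow> j < k \<Longrightarrow> v i \<bullet> (M *v v j) = of_bool (i = j)"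
    by auto
  have "dim (v ` {..<k}) \<le> k"
    using dim_le_card'[of "v ` {..<k}"] card_image_le[of "{..<k}" v] by simp
  then have "span (v ` {..<k}) \<noteq> UNIV"
    using Suc.prems by (metis DIM_cart DIM_real Suc_le_lessD dim_UNIV dim_span leD mult.right_neutral)
  then obtain x where x: "x \<notin> span (v ` {..<k})" by blast
  define y where "y = x - (\<Sum>j<k. (v j \<bullet> (M *v x)) *\<^sub>R v j)"
  have "(\<Sum>j<k. (v j \<bullet> (M *v x)) *\<^sub>R v j) \<in> span (v ` {..<k})"
    by (intro span_sum span_scale span_base) auto
  then have "y \<noteq> 0" using x by (auto simp: y_def)
  then have pos: "0 < y \<bullet> (M *v y)" using M by (simp add: pos_def_def)
  have orth: "v i \<bullet> (M *v y) = 0" if "i < k" for i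
  proof -
    have "v i \<bullet> (M *v y) = v i \<bullet> (M *v x) - (\<Sum>j<k. (v j \<bullet> (M *v x)) * (v i \<bullet> (M *v v j)))"
      by (simp add: y_def matrix_vector_mult_diff_distrib inner_diff_right inner_sum_right
          linear_sum[OF matrix_vector_mul_linear] matrix_vector_mult_scaleR o_def)
    also have "\<dots> = 0"
      using that by (simp add: v)
    finally show ?thesis .
  qed
  have sym: "a \<bullet> (M *v b) = b \<bullet> (M *v a)" for a b
    using M by (intro symmetric_mat_inner) (simp add: pos_def_def)
  define w where "w = v(k := (1 / sqrt (y \<bullet> (M *v y))) *\<^sub>R y)"
  have "w i \<bullet> (M *v w j) = of_bool (i = j)" if "i < Suc k" "j < Suc k" for i j
    using that pos v[of i j] orth[of i] orth[of j] sym[of y "v j"]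
    by (auto simp: w_def matrix_vector_mult_scaleR less_Suc_eq real_sqrt_mult_self abs_of_pos)
  then show ?case by blast
qed

text \<open>
  If the rows of \<open>V\<close> are a basis orthonormal for \<open>M\<close>, then \<open>V ** M ** transpose V = mat 1\<close>, so
  the transposed inverse of \<open>V\<close> serves as \<open>L\<close>. The sign of the determinant, coercivity and the value of
  the Gaussian integral are read off from this factorisation; it is cheaper than a diagonalisation.
\<close>
lemma pos_def_factor:
  fixes M :: "real^'n^'n"
  assumes M: "pos_def M"
  obtains L :: "real^'n^'n" where "invertible L" "M = transpose L ** L"
proof -
  obtain v :: "nat \<Rightarrow> real^'n" where v: "\<And>i j. i < CARD('n) \<Longrightarrow> j < CARD('n) \<Longrightarrow> v i \<bullet> (M *v v j) = of_bool (i = j)"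
    using vector_orthonormal_wrt_pos_def[OF M order_refl] by blast
  obtain e where e: "bij_betw e (UNIV::'n set) {..<CARD('n)}"
    using ex_bij_betw_finite_nat[of "UNIV::'n set"] by (auto simp: atLeast0LessThan)
  then have e': "e i < CARD('n)" "e i = e j \<longleftrightarrow> i = j" for i j
    by (auto simp: bij_betw_def inj_on_def)
  define V :: "real^'n^'n" where "V = (\<chi> i. v (e i))"
  have "V ** (M ** transpose V) = mat 1"
  proof -
    have "(V ** (M ** transpose V)) $ i $ j = v (e i) \<bullet> (M *v v (e j))" for i j
      unfolding matrix_mult_dot
      by (simp add: V_def row_def column_def  matrix_matrix_mult_def transpose_def inner_vec_def matrix_vector_mult_def)
    then show ?thesis by (simp add: vec_eq_iff v e' mat_def)
  qed
  then have V: "invertible V" "(M ** transpose V) ** V = mat 1"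
    using invertible_right_inverse matrix_left_right_inverse by blast+
  define L where "L = matrix_inv V"
  have L: "V ** L = mat 1" "L ** V = mat 1" using matrix_inv_inverse[OF V(1)] by (auto simp: L_def)
  show thesis
  proof
    have "M ** transpose V = L"
      by (metis L(1) V(2) matrix_mul_assoc matrix_mul_lid matrix_mul_rid)
    moreover have VL: "transpose V ** transpose L = mat 1" "transpose L ** transpose V = mat 1"
      using L by (metis matrix_transpose_mul transpose_mat)+
    ultimately show "M = transpose (transpose L) ** transpose L"
      by (metis matrix_mul_assoc matrix_mul_rid transpose_transpose)
    show "invertible (transpose L)" using VL unfolding invertible_def by blast
  qed
qed

lemma pos_def_invertible:
  fixes M :: "real^'n^'n"
  assumes "pos_def M" shows "invertible M"
  using pos_def_factor[OF assms] by (metis invertible_mult invertible_transpose)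

lemma pos_def_det:
  fixes M :: "real^'n^'n"
  assumes "pos_def M" shows "0 < det M"
proof -
  obtain L :: "real^'n^'n" where L: "invertible L" "M = transpose L ** L" using pos_def_factor[OF assms] .
  then have "det M = det L * det L" by (simp add: det_mul)
  then show ?thesis using L(1) by (metis invertible_det_nz not_real_square_gt_zero)
qed

lemma pos_def_transform:
  fixes M L :: "real^'n^'n"
  assumes "pos_def M" "invertible L" shows "pos_def (transpose L ** M ** L)"
  unfolding pos_def_def symmetric_mat_def
proof (intro conjI allI impI)
  show "transpose (transpose L ** M ** L) = transpose L ** M ** L"
    using assms by (simp add: pos_def_def symmetric_mat_def matrix_transpose_mul matrix_mul_assoc)
  fix v :: "real^'n" assume "v \<noteq> 0"
  then have "L *v v \<noteq> 0"
    using assms(2) by (metis invertible_def matrix_vector_mul_assoc matrix_vector_mul_lid matrix_vector_mult_0_right)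
  then show "0 < v \<bullet> (transpose L ** M ** L *v v)"
    using assms(1) unfolding pos_def_def matrix_vector_mul_assoc[symmetric] inner_matrix_vector_left[symmetric]
    by blast
qed

lemma pos_def_matrix_inv:
  fixes M :: "real^'n^'n"
  assumes "pos_def M" shows "pos_def (matrix_inv M)"
proof -
  have i: "M ** matrix_inv M = mat 1" "matrix_inv M ** M = mat 1"
    using matrix_inv_inverse[OF pos_def_invertible[OF assms]] by auto
  have "transpose (matrix_inv M) = matrix_inv M"
    using i assms unfolding pos_def_def symmetric_mat_def
    by (metis matrix_inv_eqI matrix_transpose_mul transpose_mat)
  moreover have "invertible (matrix_inv M)" using i by (auto simp: invertible_def)
  ultimately show ?thesis
    using pos_def_transform[OF assms, of "matrix_inv M"] i by (simp add: matrix_mul_assoc[symmetric])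
qed

lemma pos_def_coercive:
  fixes M :: "real^'n^'n"
  assumes "pos_def M"
  obtains c where "c > 0" "\<And>x. (norm x)\<^sup>2 \<le> c * (x \<bullet> (M *v x))"
proof -
  obtain L :: "real^'n^'n" where L: "invertible L" "M = transpose L ** L" using pos_def_factor[OF assms] .
  define K where "K = matrix_inv L"
  have K: "K *v (L *v x) = x" for x
    using matrix_inv_inverse[OF L(1)] by (simp add: K_def matrix_vector_mul_assoc)
  obtain B where B: "B > 0" "\<And>x. norm (K *v x) \<le> B * norm x"
    using linear_bounded_pos[OF matrix_vector_mul_linear[of K]] by blast
  show thesis
  proof
    show "B\<^sup>2 > 0" using B by simp
    fix x
    have "norm x \<le> B * norm (L *v x)" using B(2)[of "L *v x"] K by simp
    then have "(norm x)\<^sup>2 \<le> B\<^sup>2 * (norm (L *v x))\<^sup>2"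
      using power_mono[of "norm x" "B * norm (L *v x)" 2] by (simp add: power_mult_distrib)
    also have "(norm (L *v x))\<^sup>2 = x \<bullet> (M *v x)"
      by (simp add: L(2) power2_norm_eq_inner inner_matrix_vector_left matrix_vector_mul_assoc)
    finally show "(norm x)\<^sup>2 \<le> B\<^sup>2 * (x \<bullet> (M *v x))" .
  qed
qed

text \<open>
  The covariance of \<open>F *v x + B *v w\<close> for independent centred \<open>x\<close> and \<open>w\<close> with covariances \<open>V\<close> and
  \<open>G\<close>. As \<open>F\<close> is invertible, its first summand is already positive definite, whatever the rank of \<open>B\<close>.
\<close>
lemma pos_def_affine_covariance:
  fixes F V :: "real^'n^'n" and B :: "real^'m^'n" and G :: "real^'m^'m"
  assumes V: "pos_def V" and G: "pos_def G" and F: "invertible F"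
  shows "pos_def (F ** V ** transpose F + B ** G ** transpose B)"
  unfolding pos_def_def symmetric_mat_def
proof (intro conjI allI impI)
  show "transpose (F ** V ** transpose F + B ** G ** transpose B) = F ** V ** transpose F + B ** G ** transpose B"
    using V G unfolding transpose_add by (simp add: pos_def_def symmetric_mat_def matrix_transpose_mul matrix_mul_assoc)
  fix v :: "real^'n" assume "v \<noteq> 0"
  have "pos_def (F ** V ** transpose F)"
    using pos_def_transform[OF V invertible_transpose[OF F]] by simp
  then have "0 < v \<bullet> ((F ** V ** transpose F) *v v)" using \<open>v \<noteq> 0\<close> by (simp add: pos_def_def)
  moreover have "v \<bullet> ((B ** G ** transpose B) *v v) = (transpose B *v v) \<bullet> (G *v (transpose B *v v))"
    unfolding matrix_vector_mul_assoc[symmetric] inner_matrix_vector_left transpose_transpose ..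
  moreover have "0 \<le> (transpose B *v v) \<bullet> (G *v (transpose B *v v))"
    using G unfolding pos_def_def by (metis inner_zero_left less_eq_real_def)
  ultimately show "0 < v \<bullet> ((F ** V ** transpose F + B ** G ** transpose B) *v v)"
    by (simp add: matrix_vector_mult_add_rdistrib inner_add_right)
qed

section \<open>Linear changes of variables\<close>

text \<open>
  A transposition of coordinates maps boxes to boxes with the same side lengths.
\<close>
lemma nn_integral_lborel_linear_swap:
  fixes m n :: "'n::finite" and g :: "real^'n \<Rightarrow> ennreal"
  assumes [measurable]: "g \<in> borel_measurable borel"
  shows "(\<integral>\<^sup>+x. g (\<chi> i. x $ Transposition.transpose m n i) \<partial>lborel) = (\<integral>\<^sup>+x. g x \<partial>lborel)"
proof -
  let ?h = "\<lambda>x::real^'n. (\<chi> i. x $ Transposition.transpose m n i)"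
  have [measurable]: "?h \<in> borel \<rightarrow>\<^sub>M borel"
    by (intro borel_measurable_continuous_onI continuous_intros)
  have "lborel = distr lborel borel ?h"
  proof (rule lborel_eqI)
    fix l u :: "real^'n"
    assume le: "\<And>b. b \<in> Basis \<Longrightarrow> l \<bullet> b \<le> u \<bullet> b"
    have le': "l $ i \<le> u $ i" for i
      using le[of "axis i 1"] by (simp add: axis_in_Basis_iff cart_eq_inner_axis)
    have "?h -` box l u = box (?h l) (?h u)"
      by (auto simp: mem_box_cart) (metis transpose_involutory)+
    moreover have "(\<Prod>b\<in>Basis. (?h u - ?h l) \<bullet> b) = (\<Prod>b\<in>Basis. (u - l) \<bullet> b)"
    proof -
      have *: "(\<Prod>b\<in>Basis. (z::real^'n) \<bullet> b) = (\<Prod>i\<in>UNIV. z $ i)" for z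
        by (simp add: Basis_vec_def UNION_singleton_eq_range prod.reindex axis_eq_axis inj_on_def
            inner_axis)
      show ?thesis unfolding *
        using prod.permute [OF permutes_swap_id[of m UNIV n], where g="\<lambda>i. (u - l)$i", symmetric]
        by simp
    qed
    ultimately show "emeasure (distr lborel borel ?h) (box l u) = ennreal (\<Prod>b\<in>Basis. (u - l) \<bullet> b)"
      using le' by (subst emeasure_distr) (auto simp: emeasure_lborel_box_eq Basis_vec_def inner_axis)
  qed simp
  then have "(\<integral>\<^sup>+x. g x \<partial>lborel) = (\<integral>\<^sup>+x. g x \<partial>distr lborel borel ?h)" by simp
  then show ?thesis by (simp add: nn_integral_distr)
qed


text \<open>
  By Fubini one may integrate over coordinate \<open>m\<close> first; for fixed values of the others the shear is a
  translation of the line.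
\<close>
lemma nn_integral_lborel_linear_shear:
  fixes m n :: "'n::finite" and g :: "real^'n \<Rightarrow> ennreal"
  assumes mn: "m \<noteq> n" and [measurable]: "g \<in> borel_measurable borel"
  shows "(\<integral>\<^sup>+x. g (\<chi> i. if i = m then x $ m + x $ n else x $ i) \<partial>lborel) = (\<integral>\<^sup>+x. g x \<partial>lborel)"
proof -
  let ?h = "\<lambda>x::real^'n. (\<chi> i. if i = m then x $ m + x $ n else x $ i)"
  let ?e = "axis m (1::real) :: real^'n"
  let ?B = "Basis - {?e}"
  let ?v = "\<lambda>f. \<Sum>b\<in>Basis. f b *\<^sub>R (b::real^'n)"
  interpret L: product_sigma_finite "\<lambda>_::real^'n. lborel :: real measure" ..
  have h_eq: "?h x = x + (x $ n) *\<^sub>R ?e" for x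
    using mn by (auto simp: vec_eq_iff axis_def)
  have [measurable]: "?h \<in> borel \<rightarrow>\<^sub>M borel"
    unfolding h_eq by (intro borel_measurable_continuous_onI continuous_intros)
  have split: "(\<integral>\<^sup>+x. k x \<partial>lborel) =
      (\<integral>\<^sup>+f. \<integral>\<^sup>+y. k ((\<Sum>b\<in>?B. f b *\<^sub>R b) + y *\<^sub>R ?e) \<partial>lborel \<partial>PiM ?B (\<lambda>_. lborel))"
    if [measurable]: "k \<in> borel_measurable borel" for k :: "real^'n \<Rightarrow> ennreal"
  proof -
    have ins: "insert ?e ?B = Basis" by auto
    have sum_upd: "?v (f(?e := y)) = (\<Sum>b\<in>?B. f b *\<^sub>R b) + y *\<^sub>R ?e" for f :: "real^'n \<Rightarrow> real" and y
      by (subst sum.remove[of _ ?e]) (auto intro!: sum.cong)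
    have "(\<integral>\<^sup>+x. k x \<partial>lborel) = (\<integral>\<^sup>+f. k (?v f) \<partial>PiM (insert ?e ?B) (\<lambda>_. lborel))"
      unfolding ins by (subst lborel_eq, subst nn_integral_distr) auto
    also have "\<dots> = (\<integral>\<^sup>+f. \<integral>\<^sup>+y. k (?v (f(?e := y))) \<partial>lborel \<partial>PiM ?B (\<lambda>_. lborel))"
      by (rule L.product_nn_integral_insert) (auto simp: insert_absorb)
    finally show ?thesis unfolding sum_upd .
  qed
  have comp_n: "((\<Sum>b\<in>?B. f b *\<^sub>R b) + y *\<^sub>R ?e) $ n = (\<Sum>b\<in>?B. f b *\<^sub>R b) $ n" for f y
    using mn by (simp add: axis_def)
  have "(\<integral>\<^sup>+x. g (?h x) \<partial>lborel) =
      (\<integral>\<^sup>+f. \<integral>\<^sup>+y. g ((\<Sum>b\<in>?B. f b *\<^sub>R b) + ((\<Sum>b\<in>?B. f b *\<^sub>R b) $ n + 1 * y) *\<^sub>R ?e) \<partial>lborel \<partial>PiM ?B (\<lambda>_. lborel))"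
  proof -
    have "(\<Sum>b\<in>?B. f b *\<^sub>R b) + y *\<^sub>R ?e + (\<Sum>b\<in>?B. f b *\<^sub>R b) $ n *\<^sub>R ?e =
        (\<Sum>b\<in>?B. f b *\<^sub>R b) + ((\<Sum>b\<in>?B. f b *\<^sub>R b) $ n + 1 * y) *\<^sub>R ?e" for f y
      by (simp only: scaleR_add_left) simp
    then show ?thesis
      unfolding h_eq using split[of "\<lambda>x. g (x + (x $ n) *\<^sub>R ?e)"] by (simp only: comp_n) simp
  qed
  also have "\<dots> = (\<integral>\<^sup>+f. \<integral>\<^sup>+y. g ((\<Sum>b\<in>?B. f b *\<^sub>R b) + y *\<^sub>R ?e) \<partial>lborel \<partial>PiM ?B (\<lambda>_. lborel))"
  proof (rule nn_integral_cong)
    fix f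
    show "(\<integral>\<^sup>+y. g ((\<Sum>b\<in>?B. f b *\<^sub>R b) + ((\<Sum>b\<in>?B. f b *\<^sub>R b) $ n + 1 * y) *\<^sub>R ?e) \<partial>lborel)
        = (\<integral>\<^sup>+y. g ((\<Sum>b\<in>?B. f b *\<^sub>R b) + y *\<^sub>R ?e) \<partial>lborel)"
      using nn_integral_real_affine[where f="\<lambda>y. g ((\<Sum>b\<in>?B. f b *\<^sub>R b) + y *\<^sub>R ?e)" and c=1
        and t="(\<Sum>b\<in>?B. f b *\<^sub>R b) $ n"] by simp
  qed
  also have "\<dots> = (\<integral>\<^sup>+x. g x \<partial>lborel)" by (rule split[symmetric]) simp
  finally show ?thesis .
qed

lemma nn_integral_lborel_linear_stretch:
  fixes c :: "'n::finite \<Rightarrow> real" and g :: "real^'n \<Rightarrow> ennreal"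
  assumes c: "\<And>i. c i \<noteq> 0" and [measurable]: "g \<in> borel_measurable borel"
  shows "ennreal \<bar>\<Prod>i\<in>UNIV. c i\<bar> * (\<integral>\<^sup>+x. g (\<chi> i. c i * x $ i) \<partial>lborel) = (\<integral>\<^sup>+x. g x \<partial>lborel)"
proof -
  let ?h = "\<lambda>x::real^'n. (\<chi> i. c i * x $ i)"
  have [measurable]: "?h \<in> borel \<rightarrow>\<^sub>M borel"
    by (intro borel_measurable_continuous_onI continuous_intros)
  let ?c = "\<lambda>b::real^'n. c (axis_index b)"
  have h: "?h = (\<lambda>x. 0 + (\<Sum>j\<in>Basis. (?c j * (x \<bullet> j)) *\<^sub>R j))"
  proof
    fix x
    show "?h x = 0 + (\<Sum>j\<in>Basis. (?c j * (x \<bullet> j)) *\<^sub>R j)"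
    proof -
      have "(\<Sum>j\<in>Basis. (?c j * (x \<bullet> j)) *\<^sub>R j) = (\<Sum>i\<in>UNIV. (c i * x $ i) *\<^sub>R axis i 1)"
        by (simp add: Basis_vec_def UNION_singleton_eq_range sum.reindex axis_eq_axis inj_on_def
            inner_axis)
      also have "\<dots> = ?h x"
        by (simp add: vec_eq_iff axis_def if_distrib cong: if_cong)
      finally show ?thesis by simp
    qed
  qed
  have "lborel = density (distr lborel borel ?h) (\<lambda>_. ennreal (\<Prod>j\<in>Basis. \<bar>?c j\<bar>))"
    unfolding h by (rule lborel_affine_euclidean) (simp add: c)
  also have "(\<Prod>j\<in>Basis. \<bar>?c j\<bar>) = \<bar>\<Prod>i\<in>UNIV. c i\<bar>"
    by (simp add: Basis_vec_def UNION_singleton_eq_range prod.reindex axis_eq_axis inj_on_def abs_prod)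
  finally have "(\<integral>\<^sup>+x. g x \<partial>lborel) = (\<integral>\<^sup>+x. g x \<partial>density (distr lborel borel ?h) (\<lambda>_. ennreal \<bar>\<Prod>i\<in>UNIV. c i\<bar>))"
    by simp
  then show ?thesis
    by (simp add: nn_integral_density nn_integral_distr nn_integral_cmult)
qed

text \<open>
  Every matrix is a product of elementary ones, and both sides are multiplicative, so stretches, swaps
  and shears suffice. The elementary factors with a zero row have determinant zero; since the
  determinant of the product is not zero, they do not occur.
\<close>
lemma nn_integral_lborel_linear:
  fixes f :: "real^'n \<Rightarrow> real^'n"
  assumes "linear f" "det (matrix f) \<noteq> 0" "g \<in> borel_measurable borel"
  shows "ennreal \<bar>det (matrix f)\<bar> * (\<integral>\<^sup>+x. g (f x) \<partial>lborel) = (\<integral>\<^sup>+x. g x \<partial>lborel)"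
proof -
  have "det (matrix f) \<noteq> 0 \<longrightarrow> (\<forall>g\<in>borel_measurable borel.
    ennreal \<bar>det (matrix f)\<bar> * (\<integral>\<^sup>+x. g (f x) \<partial>lborel) = (\<integral>\<^sup>+x. g x \<partial>lborel))" (is "?P f")
  proof (rule induct_linear_elementary[OF \<open>linear f\<close>])
    fix f h :: "real^'n \<Rightarrow> real^'n"
    assume lin: "linear f" "linear h" and P: "?P f" "?P h"
    show "?P (f \<circ> h)"
    proof (intro impI ballI)
      fix g :: "real^'n \<Rightarrow> ennreal" assume g[measurable]: "g \<in> borel_measurable borel"
      assume "det (matrix (f \<circ> h)) \<noteq> 0"
      then have d: "det (matrix f) \<noteq> 0" "det (matrix h) \<noteq> 0"
        and eq: "\<bar>det (matrix (f \<circ> h))\<bar> = \<bar>det (matrix f)\<bar> * \<bar>det (matrix h)\<bar>"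
        using matrix_compose[OF lin(2,1)] by (auto simp: det_mul abs_mult)
      have f[measurable]: "f \<in> borel \<rightarrow>\<^sub>M borel"
        using lin(1) by (intro borel_measurable_continuous_onI linear_continuous_on linear_conv_bounded_linear[THEN iffD1])
      have "ennreal \<bar>det (matrix (f \<circ> h))\<bar> * (\<integral>\<^sup>+x. g ((f \<circ> h) x) \<partial>lborel)
          = ennreal \<bar>det (matrix f)\<bar> * (ennreal \<bar>det (matrix h)\<bar> * (\<integral>\<^sup>+x. (\<lambda>x. g (f x)) (h x) \<partial>lborel))"
        unfolding eq by (simp add: ennreal_mult mult.assoc)
      also have "ennreal \<bar>det (matrix h)\<bar> * (\<integral>\<^sup>+x. (\<lambda>x. g (f x)) (h x) \<partial>lborel) = (\<integral>\<^sup>+x. g (f x) \<partial>lborel)"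
        by (rule P(2)[rule_format, OF d(2)]) measurable
      also have "ennreal \<bar>det (matrix f)\<bar> * \<dots> = (\<integral>\<^sup>+x. g x \<partial>lborel)"
        by (rule P(1)[rule_format, OF d(1) g])
      finally show "ennreal \<bar>det (matrix (f \<circ> h))\<bar> * (\<integral>\<^sup>+x. g ((f \<circ> h) x) \<partial>lborel) = (\<integral>\<^sup>+x. g x \<partial>lborel)" .
    qed
  next
    fix f :: "real^'n \<Rightarrow> real^'n" and i
    assume "linear f" "\<And>x. f x $ i = 0"
    then have "\<not> inj f"
      by (metis (full_types) linear_injective_imp_surjective one_neq_zero surjE vec_component)
    then show "?P f"
      using det_nz_iff_inj[OF \<open>linear f\<close>] by blast
  next
    fix c :: "'n \<Rightarrow> real"
    have det: "det (matrix (\<lambda>x::real^'n. \<chi> i. c i * x $ i)) = (\<Prod>i\<in>UNIV. c i)"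
      by (simp add: axis_def matrix_def det_diagonal)
    show "?P (\<lambda>x. \<chi> i. c i * x $ i)"
      unfolding det by (auto intro!: nn_integral_lborel_linear_stretch)
  next
    fix m n :: 'n
    let ?h = "\<lambda>v::(real, 'n) vec. \<chi> i. v $ Transposition.transpose m n i"
    have "(\<chi> i j. if Transposition.transpose m n i = j then 1 else 0) = (\<chi> i j. if j = Transposition.transpose m n i then 1 else (0::real))"
      by (auto intro!: Cart_lambda_cong)
    then have "matrix ?h = transpose(\<chi> i j. mat 1 $ i $ Transposition.transpose m n j)"
      by (auto simp: matrix_eq transpose_def axis_def mat_def matrix_def)
    then have 1: "\<bar>det (matrix ?h)\<bar> = 1"
      by (cases "m = n") (simp_all add: det_permute_columns permutes_swap_id sign_swap_id abs_mult)
    show "?P ?h" unfolding 1 by (simp add: nn_integral_lborel_linear_swap)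
  next
    fix m n :: 'n assume mn: "m \<noteq> n"
    let ?h = "\<lambda>v::(real, 'n) vec. \<chi> i. if i = m then v $ m + v $ n else v $ i"
    have "matrix ?h = (\<chi> k. if k = m then row m (mat 1) + 1 *s row n (mat 1) else row k (mat 1))"
      by (auto simp: vec_eq_iff matrix_def row_def mat_def axis_def)
    then have 1: "det (matrix ?h) = 1"
      using det_row_operation[OF mn, of "mat 1" 1] by simp
    show "?P ?h" unfolding 1 using mn by (simp add: nn_integral_lborel_linear_shear)
  qed
  with assms show ?thesis by blast
qed

lemma nn_integral_lborel_matrix:
  fixes L :: "real^'n^'n"
  assumes L: "invertible L" and g: "g \<in> borel_measurable borel"
  shows "ennreal \<bar>det L\<bar> * (\<integral>\<^sup>+x. g (L *v x) \<partial>lborel) = (\<integral>\<^sup>+x. g x \<partial>lborel)"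
  using nn_integral_lborel_linear[OF matrix_vector_mul_linear[of L] _ g] L
  by (simp add: invertible_det_nz)

lemma nn_integral_lborel_translate:
  fixes g :: "'a::euclidean_space \<Rightarrow> ennreal"
  assumes [measurable]: "g \<in> borel_measurable borel"
  shows "(\<integral>\<^sup>+x. g (x + t) \<partial>lborel) = (\<integral>\<^sup>+x. g x \<partial>lborel)"
  by (subst (2) lborel_distr_plus[of t, symmetric]) (simp add: nn_integral_distr add.commute)

lemma integrable_lborel_translate:
  fixes f :: "'a::euclidean_space \<Rightarrow> real"
  assumes "integrable lborel f"
  shows "integrable lborel (\<lambda>x. f (x + t))"
  by (rule integrable_distr[of "\<lambda>x. x + t" lborel lborel f])
    (use assms lborel_distr_plus[of t] in \<open>simp_all add: add.commute cong: distr_cong\<close>)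

lemma integral_lborel_translate:
  fixes f :: "'a::euclidean_space \<Rightarrow> real"
  assumes [measurable]: "f \<in> borel_measurable borel"
  shows "(\<integral>x. f (x + t) \<partial>lborel) = (\<integral>x. f x \<partial>lborel)"
  by (subst (2) lborel_distr_plus[of t, symmetric]) (simp add: integral_distr add.commute)

section \<open>Gaussian densities\<close>

lemma borel_measurable_matrix_vector_mult [measurable (raw)]:
  fixes M :: "real^'m^'n"
  assumes "f \<in> borel_measurable N"
  shows "(\<lambda>x. M *v f x) \<in> borel_measurable N"
  using assms
  by (rule measurable_compose) (intro borel_measurable_continuous_onI continuous_intros)

lemma nn_integral_std_gaussian:
  "(\<integral>\<^sup>+x. ennreal (exp (- (x \<bullet> x / 2))) \<partial>(lborel :: (real^'n) measure)) = ennreal (sqrt ((2 * pi) ^ CARD('n)))"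
proof -
  have 1: "(\<integral>\<^sup>+x. ennreal (exp (- (x\<^sup>2 / 2))) \<partial>(lborel::real measure)) = ennreal (sqrt (2 * pi))"
  proof -
    have "(\<integral>\<^sup>+x. ennreal (exp (- (x\<^sup>2 / 2))) \<partial>lborel) = (\<integral>\<^sup>+x. ennreal (sqrt (2 * pi)) * ennreal (std_normal_density x) \<partial>lborel)"
      by (intro nn_integral_cong) (simp add: std_normal_density_def ennreal_mult[symmetric])
    also have "\<dots> = ennreal (sqrt (2 * pi)) * (\<integral>\<^sup>+x. ennreal (std_normal_density x) \<partial>lborel)"
      by (rule nn_integral_cmult) simp
    also have "(\<integral>\<^sup>+x. ennreal (std_normal_density x) \<partial>lborel) = 1"
      by (subst nn_integral_eq_integral) auto
    finally show ?thesis by simp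
  qed
  have "(\<integral>\<^sup>+x. ennreal (exp (- (x \<bullet> x / 2))) \<partial>(lborel :: (real^'n) measure))
      = (\<integral>\<^sup>+x. (\<Prod>b\<in>Basis. ennreal (exp (- (x \<bullet> b)\<^sup>2 / 2))) \<partial>(lborel :: (real^'n) measure))"
    by (intro nn_integral_cong)
      (simp add: prod_ennreal exp_sum[symmetric] euclidean_inner[of x x for x] sum_negf sum_divide_distrib power2_eq_square)
  also have "\<dots> = (\<Prod>b\<in>(Basis::(real^'n) set). ennreal (sqrt (2 * pi)))"
    by (subst nn_integral_lborel_prod) (simp_all add: 1)
  also have "\<dots> = ennreal (sqrt ((2 * pi) ^ CARD('n)))"
    by (simp add: ennreal_power real_sqrt_power real_sqrt_mult power_mult_distrib)
  finally show ?thesis .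
qed

text \<open>
  With \<open>M = transpose L ** L\<close> the integrand is the standard Gaussian at \<open>L *v x\<close>, and
  \<open>det M = (det L)\<^sup>2\<close>.
\<close>
lemma nn_integral_gaussian:
  fixes M :: "real^'n^'n"
  assumes M: "pos_def M"
  shows "(\<integral>\<^sup>+x. ennreal (exp (- (x \<bullet> (M *v x) / 2))) \<partial>lborel) = ennreal (sqrt ((2 * pi) ^ CARD('n) / det M))"
proof -
  obtain L :: "real^'n^'n" where L: "invertible L" "M = transpose L ** L" using pos_def_factor[OF M] .
  have d: "det M = (det L)\<^sup>2" by (simp add: L(2) det_mul power2_eq_square)
  have d0: "det L \<noteq> 0" using L by (simp add: invertible_det_nz)
  have q: "x \<bullet> (M *v x) = (L *v x) \<bullet> (L *v x)" for x
    by (simp only: L(2) inner_matrix_vector_left matrix_vector_mul_assoc)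
  have "ennreal \<bar>det L\<bar> * (\<integral>\<^sup>+x. ennreal (exp (- (x \<bullet> (M *v x) / 2))) \<partial>lborel) = ennreal (sqrt ((2 * pi) ^ CARD('n)))"
    unfolding q nn_integral_std_gaussian[symmetric]
    by (rule nn_integral_lborel_matrix[OF L(1), of "\<lambda>x. ennreal (exp (- (x \<bullet> x / 2)))"]) simp
  then have "ennreal (1 / \<bar>det L\<bar>) * (ennreal \<bar>det L\<bar> * (\<integral>\<^sup>+x. ennreal (exp (- (x \<bullet> (M *v x) / 2))) \<partial>lborel))
      = ennreal (1 / \<bar>det L\<bar>) * ennreal (sqrt ((2 * pi) ^ CARD('n)))"
    by simp
  moreover have "ennreal (1 / \<bar>det L\<bar>) * ennreal \<bar>det L\<bar> = 1"
    using d0 by (simp add: ennreal_mult[symmetric])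
  ultimately show ?thesis
    unfolding d by (simp add: mult.assoc[symmetric] ennreal_mult[symmetric] real_sqrt_divide)
qed

lemma gaussian_density_pos: "pos_def V \<Longrightarrow> 0 < gaussian_density \<mu> V x"
  by (simp add: gaussian_density_def pos_def_det)

lemma gaussian_density_shift: "gaussian_density \<mu> V x = gaussian_density 0 V (x - \<mu>)"
  by (simp add: gaussian_density_def)

lemma borel_measurable_gaussian_density [measurable]:
  "(\<lambda>x. gaussian_density \<mu> V x) \<in> borel_measurable borel"
  unfolding gaussian_density_def
  by measurable

lemma nn_integral_gaussian_density:
  fixes V :: "real^'n^'n"
  assumes V: "pos_def V"
  shows "(\<integral>\<^sup>+x. ennreal (gaussian_density \<mu> V x) \<partial>lborel) = 1"
proof -
  let ?W = "matrix_inv V" and ?c = "1 / sqrt ((2 * pi) ^ CARD('n) * det V)"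
  have W: "pos_def ?W" by (rule pos_def_matrix_inv[OF V])
  have d: "det V > 0" "det ?W * det V = 1"
    using matrix_inv_inverse(2)[OF pos_def_invertible[OF V]] pos_def_det[OF V] det_mul[of ?W V] by (auto)
  then have d': "det ?W = 1 / det V" by (simp add: field_simps)
  have "(\<integral>\<^sup>+x. ennreal (gaussian_density \<mu> V x) \<partial>lborel) = (\<integral>\<^sup>+x. ennreal (gaussian_density 0 V (x + (- \<mu>))) \<partial>lborel)"
    by (simp add: gaussian_density_shift[of \<mu>])
  also have "\<dots> = (\<integral>\<^sup>+x. ennreal (gaussian_density 0 V x) \<partial>lborel)"
    by (rule nn_integral_lborel_translate) simp
  also have "\<dots> = (\<integral>\<^sup>+x. ennreal ?c * ennreal (exp (- (x \<bullet> (?W *v x) / 2))) \<partial>lborel)"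
    using d by (intro nn_integral_cong) (simp add: gaussian_density_def ennreal_mult[symmetric])
  also have "\<dots> = ennreal ?c * (\<integral>\<^sup>+x. ennreal (exp (- (x \<bullet> (?W *v x) / 2))) \<partial>lborel)"
    by (rule nn_integral_cmult) measurable
  also have "\<dots> = 1"
    using d by (simp add: nn_integral_gaussian[OF W] d' ennreal_mult[symmetric] real_sqrt_mult )
  finally show ?thesis .
qed

lemma integrable_gaussian_exp:
  fixes M :: "real^'n^'n"
  assumes M: "pos_def M"
  shows "integrable lborel (\<lambda>x. exp (- (x \<bullet> (M *v x) / 2)))"
  by (rule integrableI_nonneg) (simp_all add: nn_integral_gaussian[OF M])

text \<open>
  Half of the exponent is spent to absorb the factor \<open>(norm x)\<^sup>2\<close>, which by coercivity is at most a
  multiple of the quadratic form in the exponent; the other half is still a Gaussian.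
\<close>
lemma integrable_gaussian_norm2:
  fixes V :: "real^'n^'n"
  assumes V: "pos_def V"
  shows "integrable lborel (\<lambda>x. gaussian_density 0 V x * (norm x)\<^sup>2)"
proof -
  let ?W = "matrix_inv V"
  let ?H = "(1/2) *\<^sub>R ?W"
  have W: "pos_def ?W" by (rule pos_def_matrix_inv[OF V])
  obtain c where c: "c > 0" "\<And>x. (norm x)\<^sup>2 \<le> c * (x \<bullet> (?W *v x))"
    using pos_def_coercive[OF W] by blast
  have Hv: "?H *v x = (1/2) *\<^sub>R (?W *v x)" for x
    by (simp add: scaleR_matrix_vector_assoc)
  have "pos_def ?H"
    using W by (simp add: pos_def_def symmetric_mat_def Hv transpose_scalar)
  then have i: "integrable lborel (\<lambda>x. gaussian_density 0 V 0 * (4 * c) * exp (- (x \<bullet> (?H *v x) / 2)))"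
    using integrable_gaussian_exp by (intro integrable_mult_right) blast
  show ?thesis
  proof (rule Bochner_Integration.integrable_bound[OF i])
    show "AE x in lborel. norm (gaussian_density 0 V x * (norm x)\<^sup>2)
          \<le> norm (gaussian_density 0 V 0 * (4 * c) * exp (- (x \<bullet> (?H *v x) / 2)))"
    proof (rule AE_I2)
      fix x
      define t where "t = x \<bullet> (?W *v x)"
      have t: "t \<le> 4 * exp (t / 4)" using exp_ge_add_one_self[of "t/4"] by linarith
      have "gaussian_density 0 V x * (norm x)\<^sup>2 = gaussian_density 0 V 0 * (exp (- t / 2) * (norm x)\<^sup>2)"
        by (simp add: gaussian_density_def t_def)
      also have "\<dots> \<le> gaussian_density 0 V 0 * (exp (- t / 2) * (c * (4 * exp (t / 4))))"
        using c(2)[of x] c(1) t gaussian_density_pos[OF V, of 0 0] unfolding t_def[symmetric]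
        by (intro mult_left_mono) (auto intro: order_trans mult_left_mono)
      also have "\<dots> = gaussian_density 0 V 0 * (4 * c) * exp (- t / 4)"
      proof -
        have "exp (- t / 2) * exp (t / 4) = exp (- t / 4)" by (simp add: exp_add[symmetric])
        then show ?thesis by simp
      qed
      finally show "norm (gaussian_density 0 V x * (norm x)\<^sup>2)
          \<le> norm (gaussian_density 0 V 0 * (4 * c) * exp (- (x \<bullet> (?H *v x) / 2)))"
        using gaussian_density_pos[OF V, of 0] c(1) by (simp add: abs_mult Hv t_def abs_of_pos)
    qed
  qed measurable
qed

lemma integrable_gaussian_quadratic:
  fixes V M :: "real^'n^'n"
  assumes V: "pos_def V"
  shows "integrable lborel (\<lambda>x. gaussian_density 0 V x * (x \<bullet> (M *v x)))"
proof -
  obtain B where B: "B > 0" "\<And>x. norm (M *v x) \<le> B * norm x"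
    using linear_bounded_pos[OF matrix_vector_mul_linear[of M]] by blast
  have i: "integrable lborel (\<lambda>x. B * (gaussian_density 0 V x * (norm x)\<^sup>2))"
    by (intro integrable_mult_right integrable_gaussian_norm2[OF V])
  show ?thesis
  proof (rule Bochner_Integration.integrable_bound[OF i])
    show "AE x in lborel. norm (gaussian_density 0 V x * (x \<bullet> (M *v x)))
          \<le> norm (B * (gaussian_density 0 V x * (norm x)\<^sup>2))"
    proof (rule AE_I2)
      fix x :: "real^'n"
      have "\<bar>x \<bullet> (M *v x)\<bar> \<le> norm x * norm (M *v x)" by (rule Cauchy_Schwarz_ineq2)
      also have "\<dots> \<le> norm x * (B * norm x)" by (intro mult_left_mono B) simp
      finally have "\<bar>x \<bullet> (M *v x)\<bar> \<le> B * (norm x)\<^sup>2" by (simp add: power2_eq_square mult_ac)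
      then have "gaussian_density 0 V x * \<bar>x \<bullet> (M *v x)\<bar> \<le> gaussian_density 0 V x * (B * (norm x)\<^sup>2)"
        using gaussian_density_pos[OF V, of 0 x] by (intro mult_left_mono) auto
      then show "norm (gaussian_density 0 V x * (x \<bullet> (M *v x))) \<le> norm (B * (gaussian_density 0 V x * (norm x)\<^sup>2))"
        using gaussian_density_pos[OF V, of 0 x] B(1) by (simp add: abs_mult abs_of_pos mult_ac)
    qed
  qed measurable
qed

lemma ln_gaussian_density:
  fixes V :: "real^'n^'n"
  assumes "pos_def V"
  shows "ln (gaussian_density \<mu> V x)
    = - ((x - \<mu>) \<bullet> (matrix_inv V *v (x - \<mu>)) / 2) - ln (sqrt ((2 * pi) ^ CARD('n) * det V))"
  using pos_def_det[OF assms] by (simp add: gaussian_density_def ln_div)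

lemma gaussian_density_le:
  fixes V :: "real^'n^'n"
  assumes "pos_def V"
  shows "gaussian_density \<mu> V x \<le> gaussian_density 0 V 0"
proof -
  have "0 \<le> (x - \<mu>) \<bullet> (matrix_inv V *v (x - \<mu>))"
    using pos_def_matrix_inv[OF assms] unfolding pos_def_def by (metis inner_zero_left less_eq_real_def)
  then show ?thesis
    using pos_def_det[OF assms] by (simp add: gaussian_density_def divide_right_mono)
qed

lemma integrable_gaussian_density:
  assumes "pos_def V" shows "integrable lborel (gaussian_density \<mu> V)"
  using gaussian_density_pos[OF assms] nn_integral_gaussian_density[OF assms]
  by (intro integrableI_nonneg) (auto simp: less_imp_le)

lemma integrable_gaussian_entropy:
  fixes V :: "real^'n^'n"
  assumes V: "pos_def V"
  shows "integrable lborel (\<lambda>x. gaussian_density \<mu> V x * ln (gaussian_density \<mu> V x))"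
proof -
  have "integrable lborel (\<lambda>x. (- 1 / 2) * (gaussian_density 0 V x * (x \<bullet> (matrix_inv V *v x)))
      - ln (sqrt ((2 * pi) ^ CARD('n) * det V)) * gaussian_density 0 V x)"
    by (intro Bochner_Integration.integrable_diff integrable_mult_right integrable_gaussian_quadratic
        integrable_gaussian_density V)
  then have "integrable lborel (\<lambda>x. gaussian_density 0 V x * ln (gaussian_density 0 V x))"
    by (simp add: ln_gaussian_density[OF V] algebra_simps)
  then show ?thesis
    using integrable_lborel_translate[of "\<lambda>x. gaussian_density 0 V x * ln (gaussian_density 0 V x)" "- \<mu>"]
    by (simp add: gaussian_density_shift[of \<mu>])
qed

section \<open>Affine images of Gaussian vectors\<close>

text \<open>
  Completion of the square in the control noise. Seen as a function of the noise \<open>v + w0\<close>, the joint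
  exponent of noise and state, given that \<open>y\<close> is reached, is minimal at \<open>w0\<close>, the conditional mean of
  the noise. Hence the terms mixed in \<open>v\<close> and \<open>y\<close> cancel and the exponent splits into a function of
  \<open>v\<close> and the exponent of the centred Gaussian in \<open>y\<close> with the covariance of \<open>y\<close>.
\<close>
lemma affine_covariance_quadratic:
  fixes F V :: "real^'n^'n" and B :: "real^'m^'n" and G :: "real^'m^'m"  and y :: "real^'n" and v :: "real^'m"
  assumes V: "pos_def V" and G: "pos_def G" and F: "invertible F"
  defines "W \<equiv> matrix_inv (F ** V ** transpose F + B ** G ** transpose B)"
  defines "w0 \<equiv> G *v (transpose B *v (W *v y))"
  defines "x \<equiv> matrix_inv F *v (y - B *v (v + w0))" and "x0 \<equiv> matrix_inv F *v (B *v v)"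
  shows "(v + w0) \<bullet> (matrix_inv G *v (v + w0)) + x \<bullet> (matrix_inv V *v x)
    = v \<bullet> (matrix_inv G *v v) + x0 \<bullet> (matrix_inv V *v x0) + y \<bullet> (W *v y)"
proof -
  let ?V' = "F ** V ** transpose F + B ** G ** transpose B"
  let ?Gi = "matrix_inv G" and ?Vi = "matrix_inv V" and ?Fi = "matrix_inv F"
  have V': "pos_def ?V'" by (rule pos_def_affine_covariance[OF V G F])
  have Gi: "?Gi *v (G *v u) = u" for u
    using matrix_inv_inverse[OF pos_def_invertible[OF G]] by (simp add: matrix_vector_mul_assoc)
  have Vi: "?Vi *v (V *v u) = u" for u
    using matrix_inv_inverse[OF pos_def_invertible[OF V]] by (simp add: matrix_vector_mul_assoc)
  have Fi: "?Fi *v (F *v u) = u" "F *v (?Fi *v u) = u" for u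
    using matrix_inv_inverse[OF F] by (simp_all add: matrix_vector_mul_assoc)
  have sym: "a \<bullet> (K *v b) = b \<bullet> (K *v a)" if "pos_def K" for K :: "real^'k^'k" and a b
    using that by (intro symmetric_mat_inner) (simp add: pos_def_def)
  (* The weight vector p expresses y through the covariance; V q and G r are the conditional means of
     the state and of the noise given y. *)
  define p where "p = W *v y"
  define q where "q = transpose F *v p"
  define r where "r = transpose B *v p"
  have w0: "w0 = G *v r" by (simp add: w0_def r_def p_def)
  have y: "y = F *v (V *v q) + B *v (G *v r)"
  proof -
    have "?V' *v p = y"
      using matrix_inv_inverse[OF pos_def_invertible[OF V']] by (simp add: p_def W_def matrix_vector_mul_assoc)
    then show ?thesis
      by (simp only: q_def r_def matrix_vector_mul_assoc matrix_vector_mult_add_rdistrib matrix_mul_assoc)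
  qed
  have x: "x = V *v q - x0"
  proof -
    have "x = ?Fi *v (F *v (V *v q)) - ?Fi *v (B *v v)"
      unfolding x_def w0 by (subst y) (simp add: algebra_simps matrix_vector_right_distrib matrix_vector_mult_diff_distrib)
    then show ?thesis by (simp only: Fi x0_def)
  qed
  have e1: "(v + w0) \<bullet> (?Gi *v (v + w0)) = v \<bullet> (?Gi *v v) + 2 * (v \<bullet> r) + r \<bullet> (G *v r)"
    using sym[OF pos_def_matrix_inv[OF G], of w0 v]
    by (simp add: w0 matrix_vector_right_distrib inner_add_left inner_add_right Gi inner_commute)
  have e2: "x \<bullet> (?Vi *v x) = q \<bullet> (V *v q) - 2 * (x0 \<bullet> q) + x0 \<bullet> (?Vi *v x0)"
    using sym[OF pos_def_matrix_inv[OF V], of "V *v q" x0]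
    by (simp add: x matrix_vector_mult_diff_distrib inner_diff_left inner_diff_right Vi inner_commute)
  have e3: "x0 \<bullet> q = v \<bullet> r"
    unfolding q_def r_def x0_def inner_matrix_vector_left[symmetric] Fi ..
  have "y \<bullet> p = (F *v (V *v q)) \<bullet> p + (B *v (G *v r)) \<bullet> p"
    by (subst y) (simp add: inner_add_left)
  also have "\<dots> = q \<bullet> (V *v q) + r \<bullet> (G *v r)"
    unfolding inner_matrix_vector_left[of F] inner_matrix_vector_left[of B] q_def[symmetric] r_def[symmetric]
    by (simp only: inner_commute)
  finally show ?thesis by (simp add: e1 e2 e3 p_def)
qed

text \<open>
  The law of \<open>F *v x + B *v w\<close> for independent centred Gaussian \<open>x\<close> and \<open>w\<close>. Replacing \<open>x\<close> by the
  value \<open>y\<close> of the sum, which is possible as \<open>F\<close> is invertible, and completing the square gives a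
  density that is a constant multiple of the exponential of the right quadratic form. The constant need
  not be computed: both densities have total mass one.
\<close>
lemma nn_integral_gaussian_affine:
  fixes F V :: "real^'n^'n" and B :: "real^'m^'n" and G :: "real^'m^'m"
  assumes V: "pos_def V" and G: "pos_def G" and F: "invertible F"
    and f[measurable]: "f \<in> borel_measurable borel"
  shows "(\<integral>\<^sup>+x. ennreal (gaussian_density 0 V x) * (\<integral>\<^sup>+w. ennreal (gaussian_density 0 G w) * f (F *v x + B *v w) \<partial>lborel) \<partial>lborel)
    = (\<integral>\<^sup>+y. ennreal (gaussian_density 0 (F ** V ** transpose F + B ** G ** transpose B) y) * f y \<partial>lborel)"
proof -
  let ?V' = "F ** V ** transpose F + B ** G ** transpose B"
  let ?gV = "\<lambda>x. ennreal (gaussian_density 0 V x)" and ?gG = "\<lambda>w. ennreal (gaussian_density 0 G w)"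
  let ?Fi = "matrix_inv F" and ?W = "matrix_inv ?V'"
  let ?e = "\<lambda>y. ennreal (exp (- (y \<bullet> (?W *v y) / 2)))"
  (* c is the Jacobian of the substitution and C the integral over the centred noise; only their
     product matters. *)
  define c where "c = ennreal (1 / \<bar>det F\<bar>)"
  define C where "C = (\<integral>\<^sup>+w. ?gG w * ?gV (?Fi *v (B *v w)) \<partial>lborel)"
  have V': "pos_def ?V'" by (rule pos_def_affine_covariance[OF V G F])
  have Fi: "?Fi *v (F *v u) = u" for u
    using matrix_inv_inverse[OF F] by (simp_all add: matrix_vector_mul_assoc)
  have c: "c * ennreal \<bar>det F\<bar> = 1"
    using F by (simp add: c_def ennreal_mult[symmetric] invertible_det_nz)
  have main: "(\<integral>\<^sup>+x. ?gV x * (\<integral>\<^sup>+w. ?gG w * f (F *v x + B *v w) \<partial>lborel) \<partial>lborel)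
    = c * C * (\<integral>\<^sup>+y. ?e y * f y \<partial>lborel)" if f[measurable]: "f \<in> borel_measurable borel" for f
  proof -
    have inner: "(\<integral>\<^sup>+x. ?gV x * f (F *v x + b) \<partial>lborel) = c * (\<integral>\<^sup>+y. ?gV (?Fi *v (y - b)) * f y \<partial>lborel)" for b
    proof -
      have "(\<integral>\<^sup>+x. ?gV x * f (F *v x + b) \<partial>lborel)
          = c * (ennreal \<bar>det F\<bar> * (\<integral>\<^sup>+x. (\<lambda>z. ?gV (?Fi *v z) * f (z + b)) (F *v x) \<partial>lborel))"
        by (simp add: mult.assoc[symmetric] c Fi)
      also have "\<dots> = c * (\<integral>\<^sup>+z. ?gV (?Fi *v z) * f (z + b) \<partial>lborel)"
        by (subst nn_integral_lborel_matrix[OF F]) auto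
      also have "(\<integral>\<^sup>+z. ?gV (?Fi *v z) * f (z + b) \<partial>lborel) = (\<integral>\<^sup>+z. (\<lambda>y. ?gV (?Fi *v (y - b)) * f y) (z + b) \<partial>lborel)"
        by simp
      also have "\<dots> = (\<integral>\<^sup>+y. ?gV (?Fi *v (y - b)) * f y \<partial>lborel)"
        by (rule nn_integral_lborel_translate) measurable
      finally show ?thesis .
    qed
    have square: "(\<integral>\<^sup>+w. ?gG w * ?gV (?Fi *v (y - B *v w)) \<partial>lborel) = C * ?e y" for y
    proof -
      let ?w0 = "G *v (transpose B *v (?W *v y))"
      have "(\<integral>\<^sup>+w. ?gG w * ?gV (?Fi *v (y - B *v w)) \<partial>lborel)
          = (\<integral>\<^sup>+v. ?gG (v + ?w0) * ?gV (?Fi *v (y - B *v (v + ?w0))) \<partial>lborel)"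
        by (rule nn_integral_lborel_translate[symmetric]) measurable
      also have "\<dots> = (\<integral>\<^sup>+v. (?gG v * ?gV (?Fi *v (B *v v))) * ?e y \<partial>lborel)"
      proof (rule nn_integral_cong)
        fix v
        have "exp (- ((v + ?w0) \<bullet> (matrix_inv G *v (v + ?w0))) / 2)
            * exp (- ((?Fi *v (y - B *v (v + ?w0))) \<bullet> (matrix_inv V *v (?Fi *v (y - B *v (v + ?w0))))) / 2)
          = exp (- (v \<bullet> (matrix_inv G *v v)) / 2)
            * exp (- ((?Fi *v (B *v v)) \<bullet> (matrix_inv V *v (?Fi *v (B *v v)))) / 2) * exp (- (y \<bullet> (?W *v y) / 2))"
          using affine_covariance_quadratic[OF V G F, of v B y]
          by (simp only: exp_add[symmetric]) (simp add: field_simps)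
        then have "gaussian_density 0 G (v + ?w0) * gaussian_density 0 V (?Fi *v (y - B *v (v + ?w0)))
           = gaussian_density 0 G v * gaussian_density 0 V (?Fi *v (B *v v)) * exp (- (y \<bullet> (?W *v y) / 2))"
          by (simp only: gaussian_density_def diff_zero times_divide_times_eq times_divide_eq_left times_divide_eq_right mult_1_right)
        then show "?gG (v + ?w0) * ?gV (?Fi *v (y - B *v (v + ?w0))) = (?gG v * ?gV (?Fi *v (B *v v))) * ?e y"
          using gaussian_density_pos[OF V] gaussian_density_pos[OF G]
          by (simp add: ennreal_mult[symmetric] less_imp_le)
      qed
      also have "\<dots> = C * ?e y"
        unfolding C_def by (rule nn_integral_multc) measurable
      finally show ?thesis .
    qed
    have "(\<integral>\<^sup>+x. ?gV x * (\<integral>\<^sup>+w. ?gG w * f (F *v x + B *v w) \<partial>lborel) \<partial>lborel)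
        = (\<integral>\<^sup>+x. \<integral>\<^sup>+w. ?gG w * (?gV x * f (F *v x + B *v w)) \<partial>lborel \<partial>lborel)"
      by (subst nn_integral_cmult[symmetric]) (auto simp: mult_ac)
    also have "\<dots> = (\<integral>\<^sup>+w. \<integral>\<^sup>+x. ?gG w * (?gV x * f (F *v x + B *v w)) \<partial>lborel \<partial>lborel)"
      by (rule lborel_pair.Fubini'[symmetric]) measurable
    also have "\<dots> = (\<integral>\<^sup>+w. \<integral>\<^sup>+y. c * (?gG w * (?gV (?Fi *v (y - B *v w)) * f y)) \<partial>lborel \<partial>lborel)"
      proof (rule nn_integral_cong)
      fix w :: "real^'m"
      have "(\<integral>\<^sup>+x. ?gG w * (?gV x * f (F *v x + B *v w)) \<partial>lborel) = ?gG w * (c * (\<integral>\<^sup>+y. ?gV (?Fi *v (y - B *v w)) * f y \<partial>lborel))"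
        by (subst nn_integral_cmult) (auto simp: inner)
      also have "\<dots> = c * (?gG w * (\<integral>\<^sup>+y. ?gV (?Fi *v (y - B *v w)) * f y \<partial>lborel))"
        by (rule mult.left_commute)
      also have "\<dots> = (\<integral>\<^sup>+y. c * (?gG w * (?gV (?Fi *v (y - B *v w)) * f y)) \<partial>lborel)"
        by (simp add: nn_integral_cmult)
      finally show "(\<integral>\<^sup>+x. ?gG w * (?gV x * f (F *v x + B *v w)) \<partial>lborel)
        = (\<integral>\<^sup>+y. c * (?gG w * (?gV (?Fi *v (y - B *v w)) * f y)) \<partial>lborel)" .
    qed
    also have "\<dots> = (\<integral>\<^sup>+y. \<integral>\<^sup>+w. c * (?gG w * (?gV (?Fi *v (y - B *v w)) * f y)) \<partial>lborel \<partial>lborel)"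
      by (rule lborel_pair.Fubini') measurable
    also have "\<dots> = (\<integral>\<^sup>+y. c * ((\<integral>\<^sup>+w. ?gG w * ?gV (?Fi *v (y - B *v w)) \<partial>lborel) * f y) \<partial>lborel)"
      by (subst nn_integral_multc[symmetric], simp, subst nn_integral_cmult[symmetric]) (auto simp: mult_ac)
    also have "\<dots> = c * C * (\<integral>\<^sup>+y. ?e y * f y \<partial>lborel)"
      unfolding square by (subst nn_integral_cmult[symmetric]) (auto simp: mult_ac)
    finally show ?thesis .
  qed
  define k where "k = ennreal (1 / sqrt ((2 * pi) ^ CARD('n) * det ?V'))"
  have gV': "ennreal (gaussian_density 0 ?V' y) = k * ?e y" for y
    using pos_def_det[OF V'] by (simp add: k_def gaussian_density_def ennreal_mult[symmetric])
  have "c * C * (\<integral>\<^sup>+y. ?e y \<partial>lborel) = 1"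
    using main[of "\<lambda>_. 1"] by (simp add: nn_integral_gaussian_density[OF V] nn_integral_gaussian_density[OF G])
  moreover have "k * (\<integral>\<^sup>+y. ?e y \<partial>lborel) = 1"
    using nn_integral_gaussian_density[OF V', of 0] by (simp add: gV' nn_integral_cmult)
  moreover have "a = b" if "a * i = 1" "b * i = 1" for a b i :: ennreal
  proof -
    have "a = a * (b * i)" by (simp add: that)
    also have "\<dots> = b * (a * i)" by (simp only: mult_ac)
    finally show ?thesis by (simp add: that)
  qed
  ultimately have "c * C = k" by blast
  then show ?thesis
    unfolding main[OF f] gV' by (simp add: nn_integral_cmult mult.assoc)
qed

section \<open>Algebra of the Riccati equations\<close>

text \<open>
  The completion of squares of linear quadratic control. In the shifted control
  \<open>v = u + transpose S *v x\<close> the cross term of the cost disappears and the drift becomes \<open>F\<close>, which is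
  the form for which the Riccati equation is stated.
\<close>
lemma stage_cost_completion:
  fixes A P Q :: "real^'n^'n" and B S :: "real^'m^'n" and M :: "real^'m^'m"
  assumes P: "symmetric_mat P" and M: "M = mat 1 + transpose B ** P ** B" "invertible M"
    and P0: "P0 = transpose F ** P ** F - transpose F ** P ** B ** matrix_inv M ** transpose B ** P ** F + (Q - S ** transpose S)"
    and F: "F = A - B ** transpose S"
    and K: "K = matrix_inv M ** (transpose B ** P ** A + transpose S)"
  shows "stage_cost Q S x u + (A *v x + B *v u) \<bullet> (P *v (A *v x + B *v u)) / 2
    = x \<bullet> (P0 *v x) / 2 + (u + K *v x) \<bullet> (M *v (u + K *v x)) / 2"
proof -
  note sym = symmetric_mat_inner[OF P]
  have Msym: "symmetric_mat M"
    using P by (simp add: symmetric_mat_def M(1) transpose_add matrix_transpose_mul matrix_mul_assoc)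
  define G where "G = matrix_inv M"
  have G: "G *v (M *v a) = a" "M *v (G *v a) = a" for a
    using matrix_inv_inverse[OF M(2)] by (simp_all add: G_def matrix_vector_mul_assoc)
  define s where "s = transpose S *v x"
  define z where "z = F *v x"
  define t where "t = transpose B *v (P *v z)"
  define v where "v = u + s"
  have Ax: "A *v x = z + B *v s"
    by (simp only: z_def s_def F matrix_vector_mul_assoc matrix_vector_mult_diff_rdistrib diff_add_cancel)
  have next_state: "A *v x + B *v u = z + B *v v"
    by (simp add: Ax v_def matrix_vector_right_distrib)
  have Mv: "M *v a = a + transpose B *v (P *v (B *v a))" for a
    by (simp only: M(1) matrix_vector_mult_add_rdistrib matrix_vector_mul_lid matrix_vector_mul_assoc matrix_mul_assoc)
  have Kx: "K *v x = G *v t + s"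
  proof -
    have "K *v x = G *v (transpose B *v (P *v (A *v x)) + s)"
      by (simp only: K G_def s_def matrix_vector_mult_add_rdistrib matrix_vector_mul_assoc[symmetric])
    also have "transpose B *v (P *v (A *v x)) + s = t + M *v s"
      by (simp only: Ax t_def Mv matrix_vector_right_distrib add_ac)
    finally show ?thesis by (simp only: matrix_vector_right_distrib G)
  qed
  have x0: "x \<bullet> (P0 *v x) = z \<bullet> (P *v z) - t \<bullet> (G *v t) + (x \<bullet> (Q *v x) - s \<bullet> s)"
  proof -
    have "P0 *v x = transpose F *v (P *v z) - transpose F *v (P *v (B *v (G *v t))) + (Q *v x - S *v s)"
      by (simp only: P0 G_def s_def t_def z_def matrix_vector_mult_add_rdistrib matrix_vector_mult_diff_rdistrib
          matrix_vector_mul_assoc matrix_mul_assoc)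
    moreover have "x \<bullet> (transpose F *v a) = z \<bullet> a" for a
      by (simp only: z_def inner_matrix_vector_left)
    moreover have "z \<bullet> (P *v (B *v a)) = t \<bullet> a" for a
      using sym[of z "B *v a"] inner_matrix_vector_left[of B a "P *v z"]
      by (simp only: t_def inner_commute[of a])
    moreover have "x \<bullet> (S *v a) = s \<bullet> a" for a
      using inner_matrix_vector_left[of S a x] by (simp only: s_def inner_commute)
    ultimately show ?thesis by (simp only: inner_add_right inner_diff_right)
  qed
  have "stage_cost Q S x u = (x \<bullet> (Q *v x) - s \<bullet> s + v \<bullet> v) / 2"
  proof -
    have "x \<bullet> (S *v u) = u \<bullet> s"
      using inner_matrix_vector_left[of S u x] by (simp only: s_def inner_commute)
    then show ?thesis
      by (simp only: stage_cost_def s_def[symmetric] v_def inner_add_left inner_add_right inner_commute[of s u])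
        simp
  qed
  moreover have "(z + B *v v) \<bullet> (P *v (z + B *v v)) = z \<bullet> (P *v z) + 2 * (v \<bullet> t) + v \<bullet> (M *v v) - v \<bullet> v"
  proof -
    have "(B *v v) \<bullet> a = v \<bullet> (transpose B *v a)" for a by (rule inner_matrix_vector_left)
    then show ?thesis
      by (simp only: matrix_vector_right_distrib inner_add_left inner_add_right sym[of z "B *v v"] t_def Mv)
  qed
  moreover have "(u + K *v x) \<bullet> (M *v (u + K *v x)) = v \<bullet> (M *v v) + 2 * (v \<bullet> t) + t \<bullet> (G *v t)"
  proof -
    have "u + K *v x = v + G *v t" by (simp add: Kx v_def)
    then show ?thesis
      by (simp only: matrix_vector_right_distrib G inner_add_left inner_add_right
          symmetric_mat_inner[OF Msym, of "G *v t" v] inner_commute[of "G *v t" t])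
  qed
  ultimately show ?thesis
    unfolding next_state x0 by (simp add: field_simps)
qed

text \<open>
  One step of the covariance recursion of the closed loop \<open>C\<close> agrees with the pair of Riccati
  equations: if \<open>V\<close> is the inverse of \<open>P0 + H0\<close>, the next covariance is the inverse of \<open>P + H\<close>.

  With \<open>T\<close> the inverse of \<open>1 + B B\<^sup>T P\<close> and \<open>U\<close> the inverse of \<open>E = 1 - B B\<^sup>T H\<close>, the two equations
  read \<open>P0 = F\<^sup>T (P T) F + Q0\<close> and \<open>H0 = F\<^sup>T (H U) F - Q0\<close>, while \<open>C = T F\<close> and \<open>B G B\<^sup>T = T B B\<^sup>T\<close>.
  In the sum \<open>Q0\<close> cancels, so \<open>X = F V F\<^sup>T\<close> is the inverse of \<open>P T + H U\<close>. The claim then becomes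
  \<open>X T\<^sup>T (P + H) = E\<close>, which holds because \<open>T\<^sup>T (P + H) = (P T + H U) E\<close>.
\<close>
lemma closed_loop_covariance:
  fixes A F P H Q0 V :: "real^'n^'n" and B S :: "real^'m^'n"
  assumes P: "symmetric_mat P" and H: "symmetric_mat H"
    and F: "F = A - B ** transpose S" "invertible F"
    and G: "invertible (mat 1 + transpose B ** P ** B)" "G = matrix_inv (mat 1 + transpose B ** P ** B)"
    and L: "invertible (- mat 1 + transpose B ** H ** B)" "L = matrix_inv (- mat 1 + transpose B ** H ** B)"
    and P0: "P0 = transpose F ** P ** F - transpose F ** P ** B ** G ** transpose B ** P ** F + Q0"
    and H0: "H0 = transpose F ** H ** F - transpose F ** H ** B ** L ** transpose B ** H ** F - Q0"
    and V: "V ** (P0 + H0) = mat 1"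
    and C: "C = A - B ** (G ** (transpose B ** P ** A + transpose S))"
  shows "invertible C" "(C ** V ** transpose C + B ** G ** transpose B) ** (P + H) = mat 1"
proof -
  note ring = matrix_diff_ldistrib matrix_diff_rdistrib matrix_add_ldistrib matrix_add_rdistrib
    matrix_mul_lid matrix_mul_rid matrix_mul_assoc[symmetric]
  let ?B' = "transpose B"
  have GM: "G + G ** (?B' ** (P ** B)) = mat 1"
    using matrix_inv_inverse(2)[OF G(1)] unfolding G(2)[symmetric] by (simp only: ring)
  have MG: "G + ?B' ** (P ** (B ** G)) = mat 1"
    using matrix_inv_inverse(1)[OF G(1)] unfolding G(2)[symmetric] by (simp only: ring)
  (* GMr and LMr are cancellation rules for products associated to the right. *)
  have GMr: "G ** (?B' ** (P ** (B ** R))) = R - G ** R" for R :: "real^'k^'m"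
  proof -
    have "(G + G ** (?B' ** (P ** B))) ** R = R" by (simp only: GM matrix_mul_lid)
    then show ?thesis by (simp only: ring) (metis add_diff_cancel_left')
  qed
  have LMr: "L ** (?B' ** (H ** (B ** R))) = R + L ** R" for R :: "real^'k^'m"
  proof -
    have "- mat 1 + ?B' ** H ** B = ?B' ** H ** B - mat 1" by simp
    then have "L ** ((?B' ** H ** B - mat 1) ** R) = R"
      using matrix_inv_inverse(2)[OF L(1)] unfolding L(2)[symmetric] by (simp only: matrix_mul_assoc matrix_mul_lid)
    then show ?thesis by (simp only: ring) (metis diff_add_cancel)
  qed
  have Gsym: "transpose G = G"
  proof -
    have "transpose (mat 1 + ?B' ** P ** B) = mat 1 + ?B' ** P ** B"
      using P by (simp add: symmetric_mat_def transpose_add matrix_transpose_mul matrix_mul_assoc)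
    then have "(mat 1 + ?B' ** P ** B) ** transpose G = mat 1"
      using matrix_inv_inverse(2)[OF G(1)] unfolding G(2)[symmetric]
      by (metis matrix_transpose_mul transpose_mat)
    then show ?thesis unfolding G(2) using matrix_inv_eqI by metis
  qed
  define T where "T = mat 1 - B ** (G ** (?B' ** P))"
  define U where "U = mat 1 - B ** (L ** (?B' ** H))"
  define E where "E = mat 1 - B ** (?B' ** H)"
  have T1: "T ** (mat 1 + B ** (?B' ** P)) = mat 1"
    unfolding T_def by (simp only: ring GMr) simp
  have T2: "(mat 1 + B ** (?B' ** P)) ** T = mat 1"
    using T1 matrix_left_right_inverse by blast
  have UE: "U ** E = mat 1"
    unfolding U_def E_def by (simp only: ring LMr) simp
  have TB: "T ** (B ** ?B') = B ** (G ** ?B')"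
    unfolding T_def by (simp only: ring GMr) simp
  have CF: "C = T ** F"
    unfolding C F(1) T_def by (simp only: ring GMr) (simp add: algebra_simps)
  show "invertible C"
    unfolding CF using F(2) T1 T2 invertible_def invertible_mult by blast
  have T': "transpose T = mat 1 - P ** (B ** (G ** ?B'))"
    using P by (simp add: T_def transpose_diff matrix_transpose_mul Gsym symmetric_mat_def matrix_mul_assoc)
  have PT: "P ** T = transpose T ** P"
    unfolding T' unfolding T_def by (simp only: ring)
  have T'eq: "transpose T ** (P ** (B ** ?B')) = mat 1 - transpose T"
  proof -
    have "transpose T ** (mat 1 + P ** (B ** ?B')) = mat 1"
    proof -
      have "transpose (mat 1 + B ** (?B' ** P)) = mat 1 + P ** (B ** ?B')"
        using P by (simp add: transpose_add matrix_transpose_mul symmetric_mat_def matrix_mul_assoc)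
      then show ?thesis using T2 by (metis matrix_transpose_mul transpose_mat)
    qed
    then show ?thesis by (simp only: ring) (metis add_diff_cancel_left')
  qed
  have sum0: "P0 + H0 = transpose F ** ((P ** T + H ** U) ** F)"
    unfolding P0 H0 T_def U_def by (simp only: ring) simp
  define X where "X = F ** (V ** transpose F)"
  have X: "X ** (P ** T + H ** U) = mat 1"
  proof -
    have "V ** (transpose F ** (P ** T + H ** U)) ** F = mat 1"
      using V unfolding sum0 by (simp only: matrix_mul_assoc)
    then have "F ** (V ** (transpose F ** (P ** T + H ** U))) = mat 1"
      using matrix_left_right_inverse by blast
    then show ?thesis by (simp only: X_def matrix_mul_assoc)
  qed
  have XE: "X ** (transpose T ** (P + H)) = E"
  proof -
    have "transpose T ** (P + H) = P ** T ** E + H ** (U ** E)"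
    proof -
      have "transpose T ** (P ** (B ** (?B' ** H))) = H - transpose T ** H"
      proof -
        have "transpose T ** (P ** (B ** ?B')) ** H = (mat 1 - transpose T) ** H" by (simp only: T'eq)
        then show ?thesis by (simp only: ring)
      qed
      then show ?thesis unfolding UE PT unfolding E_def by (simp only: ring) simp
    qed
    also have "\<dots> = (P ** T + H ** U) ** E" by (simp only: ring)
    finally have "X ** (transpose T ** (P + H)) = X ** (P ** T + H ** U) ** E"
      by (simp only: matrix_mul_assoc)
    then show ?thesis by (simp only: X matrix_mul_lid)
  qed
  have "(C ** V ** transpose C + B ** G ** ?B') ** (P + H)
      = T ** (X ** (transpose T ** (P + H)) + B ** (?B' ** (P + H)))"
  proof -
    have "(C ** V ** transpose C + B ** G ** ?B') = T ** (X ** transpose T) + T ** (B ** ?B')"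
      unfolding TB by (simp only: CF X_def matrix_transpose_mul matrix_mul_assoc)
    then show ?thesis by (simp only: matrix_add_ldistrib matrix_add_rdistrib matrix_mul_assoc add_ac)
  qed
  also have "\<dots> = T ** (mat 1 + B ** (?B' ** P))"
    unfolding XE E_def by (simp add: matrix_add_ldistrib)
  finally show "(C ** V ** transpose C + B ** G ** ?B') ** (P + H) = mat 1" by (simp only: T1)
qed

section \<open>Laws of histories\<close>

lemma extend_hist_measurable [measurable]:
  "(\<lambda>(h, u). extend_hist A B k h u) \<in> hist_space k \<Otimes>\<^sub>M borel \<rightarrow>\<^sub>M hist_space (Suc k)"
proof -
  have "(\<lambda>z. ((fst (fst z))(Suc k := A k *v fst (fst z) k + B k *v snd z), (snd (fst z))(k := snd z)))
    \<in> hist_space k \<Otimes>\<^sub>M borel \<rightarrow>\<^sub>M hist_space (Suc k)"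
    unfolding hist_space_def
  proof (rule measurable_Pair)
    let ?M = "(Pi\<^sub>M {..k} (\<lambda>_. borel) \<Otimes>\<^sub>M Pi\<^sub>M {..<k} (\<lambda>_. borel)) \<Otimes>\<^sub>M borel
      :: (('a, 'b) history \<times> (real^'b)) measure"
    show "(\<lambda>z. (fst (fst z))(Suc k := A k *v fst (fst z) k + B k *v snd z)) \<in> ?M \<rightarrow>\<^sub>M Pi\<^sub>M {..Suc k} (\<lambda>_. borel)"
      by (rule measurable_fun_upd[where J="{..k}"]) (auto, measurable)
    show "(\<lambda>z. (snd (fst z))(k := snd z)) \<in> ?M \<rightarrow>\<^sub>M Pi\<^sub>M {..<Suc k} (\<lambda>_. borel)"
      by (rule measurable_fun_upd[where J="{..<k}"]) auto
  qed
  then show ?thesis by (simp add: extend_hist_def split_beta')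
qed

lemma hist_state_measurable [measurable]: "j \<le> k \<Longrightarrow> (\<lambda>h. fst h j) \<in> borel_measurable (hist_space k)"
  unfolding hist_space_def by measurable

lemma hist_control_measurable [measurable]: "j < k \<Longrightarrow> (\<lambda>h. snd h j) \<in> borel_measurable (hist_space k)"
  unfolding hist_space_def by measurable

lemma hist_at_measurable [measurable]: "j \<le> k \<Longrightarrow> hist_at j \<in> hist_space k \<rightarrow>\<^sub>M hist_space j"
  unfolding hist_space_def hist_at_def
  by (intro measurable_Pair measurable_compose[OF measurable_fst measurable_restrict_subset]
      measurable_compose[OF measurable_snd measurable_restrict_subset]) auto

lemma hist_at_extend:
  "j \<le> k \<Longrightarrow> hist_at j (extend_hist A B k h u) = hist_at j h"
  by (auto simp: hist_at_def extend_hist_def restrict_def fun_eq_iff)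

lemma hist_at_same: "h \<in> space (hist_space k) \<Longrightarrow> hist_at k h = h"
  by (auto simp: hist_at_def hist_space_def space_pair_measure space_PiM PiE_def extensional_restrict)

lemma extend_hist_simps [simp]:
  "fst (extend_hist A B k h u) (Suc k) = A k *v fst h k + B k *v u"
  "j \<le> k \<Longrightarrow> fst (extend_hist A B k h u) j = fst h j"
  "snd (extend_hist A B k h u) k = u"
  "j < k \<Longrightarrow> snd (extend_hist A B k h u) j = snd h j"
  by (auto simp: extend_hist_def)

text \<open>
  A system driven by a policy, with a Gaussian initial state. Only the decisions before time \<open>N\<close> are
  constrained, so the facts below concern histories up to time \<open>N\<close>.
\<close>
locale controlled_process =
  fixes N :: nat and A :: "nat \<Rightarrow> real^'n^'n" and B :: "nat \<Rightarrow> real^'m^'n" and V0 :: "real^'n^'n"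
    and \<pi> :: "('n::finite, 'm::finite) policy"
  assumes V0: "pos_def V0" and policy: "is_policy N \<pi>"
begin

abbreviation law :: "nat \<Rightarrow> ('n, 'm) history measure" where
  "law \<equiv> hist_law A B V0 \<pi>"

definition step :: "nat \<Rightarrow> ('n, 'm) history \<Rightarrow> ('n, 'm) history measure" where
  "step k h = distr (density lborel (\<lambda>u. ennreal (\<pi> k h u))) (hist_space (Suc k)) (extend_hist A B k h)"

lemma policy_measurable: "k < N \<Longrightarrow> (\<lambda>(h, u). \<pi> k h u) \<in> borel_measurable (hist_space k \<Otimes>\<^sub>M lborel)"
  using policy by (simp add: is_policy_def cong: measurable_cong_sets)

lemma policy_section_measurable: "k < N \<Longrightarrow> h \<in> space (hist_space k) \<Longrightarrow> \<pi> k h \<in> borel_measurable borel"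
  using measurable_Pair2[OF policy_measurable, of k h] by simp

lemma policy_nonneg: "k < N \<Longrightarrow> h \<in> space (hist_space k) \<Longrightarrow> 0 \<le> \<pi> k h u"
  and policy_nn_integral: "k < N \<Longrightarrow> h \<in> space (hist_space k) \<Longrightarrow> (\<integral>\<^sup>+u. ennreal (\<pi> k h u) \<partial>lborel) = 1"
  using policy by (auto simp: is_policy_def)

lemma step_measurable:
  assumes k: "k < N"
  shows "step k \<in> hist_space k \<rightarrow>\<^sub>M prob_algebra (hist_space (Suc k))"
proof (rule measurable_prob_algebraI)
  note [measurable] = policy_measurable[OF k]
  have [measurable]: "(\<lambda>(h, u). extend_hist A B k h u) \<in> hist_space k \<Otimes>\<^sub>M lborel \<rightarrow>\<^sub>M hist_space (Suc k)"
    using extend_hist_measurable by (simp cong: measurable_cong_sets)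
  have p: "prob_space (density lborel (\<lambda>u. ennreal (\<pi> k h u)))" if "h \<in> space (hist_space k)" for h
    using policy_section_measurable[OF k that] policy_nn_integral[OF k that]
    by (intro prob_spaceI) (simp add: emeasure_density)
  have d: "(\<lambda>h. density lborel (\<lambda>u. ennreal (\<pi> k h u))) \<in> hist_space k \<rightarrow>\<^sub>M subprob_algebra lborel"
  proof (rule measurable_subprob_algebra)
    fix X :: "(real^'m) set" assume [measurable]: "X \<in> sets lborel"
    have "(\<lambda>h. \<integral>\<^sup>+u. ennreal (\<pi> k h u) * indicator X u \<partial>lborel) \<in> borel_measurable (hist_space k)"
      by measurable
    then show "(\<lambda>h. emeasure (density lborel (\<lambda>u. ennreal (\<pi> k h u))) X) \<in> borel_measurable (hist_space k)"
      by (rule measurable_cong[THEN iffD1, rotated])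
        (subst emeasure_density, use policy_section_measurable[OF k] \<open>X \<in> sets lborel\<close> in auto)
  qed (simp_all add: p prob_space_imp_subprob_space)
  show "step k \<in> hist_space k \<rightarrow>\<^sub>M subprob_algebra (hist_space (Suc k))"
    unfolding step_def[abs_def] by (rule measurable_distr2[OF _ d]) measurable
  fix h :: "('n, 'm) history" assume h: "h \<in> space (hist_space k)"
  show "prob_space (step k h)"
    unfolding step_def
    by (rule prob_space.prob_space_distr[OF p[OF h]])
      (use measurable_Pair2[OF extend_hist_measurable h, of A B] in simp)
qed

lemma law_Suc: "law (Suc k) = law k \<bind> step k"
  by (simp add: step_def[abs_def])

lemma law_0: "law 0 = distr (density lborel (\<lambda>x. ennreal (gaussian_density 0 V0 x))) (hist_space 0)
       (\<lambda>x. (restrict (\<lambda>_. x) {..0}, restrict (\<lambda>_. 0) {..<0}))"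
  by simp

lemma initial_history_measurable [measurable]:
  "(\<lambda>x::real^'n. (restrict (\<lambda>_. x) {..0}, restrict (\<lambda>_. 0) {..<0}) :: ('n,'m) history) \<in> borel \<rightarrow>\<^sub>M hist_space 0"
  unfolding hist_space_def by measurable

lemma law_in_prob_algebra: "k \<le> N \<Longrightarrow> law k \<in> space (prob_algebra (hist_space k))"
proof (induction k)
  case 0
  have "prob_space (density lborel (\<lambda>x. ennreal (gaussian_density 0 V0 x)))"
    by (intro prob_spaceI) (simp add: emeasure_density nn_integral_gaussian_density[OF V0])
  then have "prob_space (law 0)"
    unfolding law_0 by (rule prob_space.prob_space_distr) (use initial_history_measurable in simp)
  then show ?case by (simp add: space_prob_algebra)
next
  case (Suc k)
  then have 1: "law k \<in> space (prob_algebra (hist_space k))" and "k < N" by auto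
  note 2 = step_measurable[OF \<open>k < N\<close>]
  show ?case
    unfolding law_Suc space_prob_algebra[of "hist_space (Suc k)"]
    using prob_space_bind'[OF 1 2] sets_bind'[OF 1 2] by blast
qed

lemma sets_law [measurable_cong]: "k \<le> N \<Longrightarrow> sets (law k) = sets (hist_space k)"
  and prob_space_law: "k \<le> N \<Longrightarrow> prob_space (law k)"
  using law_in_prob_algebra[of k] by (auto simp: space_prob_algebra)

lemma space_law: "k \<le> N \<Longrightarrow> space (law k) = space (hist_space k)"
  using sets_law by (rule sets_eq_imp_space_eq)

lemma law_Suc_nn_integral:
  assumes k: "k < N" and f[measurable]: "f \<in> borel_measurable (hist_space (Suc k))"
  shows "(\<integral>\<^sup>+h. f h \<partial>law (Suc k)) = (\<integral>\<^sup>+h. \<integral>\<^sup>+u. ennreal (\<pi> k h u) * f (extend_hist A B k h u) \<partial>lborel \<partial>law k)"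
proof -
  have "(\<integral>\<^sup>+h. f h \<partial>law (Suc k)) = (\<integral>\<^sup>+h. \<integral>\<^sup>+h'. f h' \<partial>step k h \<partial>law k)"
    unfolding law_Suc
    by (rule nn_integral_bind[OF f])
      (use measurable_prob_algebraD[OF step_measurable[OF k]] sets_law[of k] k in \<open>simp cong: measurable_cong_sets\<close>)
  also have "\<dots> = (\<integral>\<^sup>+h. \<integral>\<^sup>+u. ennreal (\<pi> k h u) * f (extend_hist A B k h u) \<partial>lborel \<partial>law k)"
  proof (rule nn_integral_cong)
    fix h assume "h \<in> space (law k)"
    then have h: "h \<in> space (hist_space k)" using space_law k by simp
    note [measurable] = policy_section_measurable[OF k h]
    have [measurable]: "extend_hist A B k h \<in> borel \<rightarrow>\<^sub>M hist_space (Suc k)"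
      using measurable_Pair2[OF extend_hist_measurable h, of A B] by simp
    show "(\<integral>\<^sup>+h'. f h' \<partial>step k h) = (\<integral>\<^sup>+u. ennreal (\<pi> k h u) * f (extend_hist A B k h u) \<partial>lborel)"
      unfolding step_def by (simp add: nn_integral_distr nn_integral_density)
  qed
  finally show ?thesis .
qed

text \<open>
  The law of the extended history as an image of a measure with a density on a product space. This
  form makes Fubini's theorem for integrands of either sign available.
\<close>
lemma law_Suc_eq_distr:
  assumes k: "k < N"
  shows "law (Suc k) = distr (density (law k \<Otimes>\<^sub>M lborel) (\<lambda>(h, u). ennreal (\<pi> k h u))) (hist_space (Suc k))
    (\<lambda>(h, u). extend_hist A B k h u)"
proof (rule measure_eqI)
  have [measurable_cong]: "sets (law k) = sets (hist_space k)" using k sets_law by simp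
  note [measurable] = policy_measurable[OF k]
  have [measurable]: "(\<lambda>(h, u). extend_hist A B k h u) \<in> hist_space k \<Otimes>\<^sub>M lborel \<rightarrow>\<^sub>M hist_space (Suc k)"
    using extend_hist_measurable by (simp cong: measurable_cong_sets)
  let ?D = "distr (density (law k \<Otimes>\<^sub>M lborel) (\<lambda>(h, u). ennreal (\<pi> k h u))) (hist_space (Suc k))
    (\<lambda>(h, u). extend_hist A B k h u)"
  interpret pair_sigma_finite "law k" "lborel :: (real^'m) measure"
    using prob_space_law[of k] k
    by (intro pair_sigma_finite.intro) (auto intro: prob_space_imp_sigma_finite sigma_finite_lborel)
  show "sets (law (Suc k)) = sets ?D" using k sets_law[of "Suc k"] by simp
  fix X assume "X \<in> sets (law (Suc k))"
  then have X[measurable]: "X \<in> sets (hist_space (Suc k))" using k sets_law[of "Suc k"] by simp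
  have "emeasure (law (Suc k)) X = (\<integral>\<^sup>+h. indicator X h \<partial>law (Suc k))"
    using X k sets_law[of "Suc k"] by (simp del: hist_law.simps)
  also have "\<dots> = (\<integral>\<^sup>+h. \<integral>\<^sup>+u. ennreal (\<pi> k h u) * indicator X (extend_hist A B k h u) \<partial>lborel \<partial>law k)"
    by (rule law_Suc_nn_integral[OF k]) measurable
  also have "\<dots> = (\<integral>\<^sup>+z. (case z of (h, u) \<Rightarrow> ennreal (\<pi> k h u) * indicator X (extend_hist A B k h u)) \<partial>(law k \<Otimes>\<^sub>M lborel))"
    by (subst lborel.nn_integral_fst[symmetric]) auto
  also have "\<dots> = emeasure ?D X"
    by (simp add: nn_integral_indicator[symmetric] nn_integral_distr nn_integral_density split_beta' del: nn_integral_indicator)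
  finally show "emeasure (law (Suc k)) X = emeasure ?D X" .
qed

end

section \<open>Gibbs inequality along a trajectory\<close>

text \<open>
  The pointwise form of Gibbs' inequality; the case \<open>p = 0\<close> relies on \<open>0 * ln 0 = 0\<close>.
\<close>
lemma gibbs_pointwise:
  fixes p r :: real
  assumes "0 \<le> p" "0 < r"
  shows "p - r \<le> p * ln p - p * ln r" and "p * ln p - p * ln r = p - r \<Longrightarrow> p = r"
proof -
  have *: "p - r \<le> p * ln p - p * ln r \<and> (p * ln p - p * ln r = p - r \<longrightarrow> p = r)"
  proof (cases "p = 0")
    case False
    then have p: "p > 0" using assms by simp
    have eq: "p * ln p - p * ln r = - p * ln (r / p)"
      using p assms by (simp add: ln_div algebra_simps)
    have "ln (r / p) \<le> r / p - 1" using p assms by (intro ln_le_minus_one) simp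
    then have "p * ln (r / p) \<le> p * (r / p - 1)" using p by (intro mult_left_mono) auto
    moreover have "p * (r / p - 1) = r - p" using p by (simp add: field_simps)
    moreover have "p = r" if "p * ln (r / p) = r - p"
    proof -
      have "ln (r / p) = r / p - 1" using that p by (simp add: field_simps)
      then have "r / p = 1" using p assms by (intro ln_eq_minus_one) auto
      then show ?thesis using p by simp
    qed
    ultimately show ?thesis unfolding eq by auto
  qed (use assms in auto)
  then show "p - r \<le> p * ln p - p * ln r" "p * ln p - p * ln r = p - r \<Longrightarrow> p = r" by auto
qed

text \<open>
  Gibbs' inequality for the choice of one control. Here \<open>p\<close> is the density of the control, \<open>r\<close> the
  reference density and \<open>Y\<close> a nonnegative remainder that depends on the control. Neither
  \<open>p u * ln (r u)\<close> nor \<open>p u * Y u\<close> is assumed to be integrable: since \<open>r\<close> is bounded, both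
  \<open>ln C - ln (r u)\<close> and \<open>Y u\<close> are nonnegative, so the integrability of the sum passes to its parts.
\<close>
lemma gibbs_conditional:
  fixes p r Y :: "'a::euclidean_space \<Rightarrow> real"
  assumes [measurable]: "p \<in> borel_measurable borel" "r \<in> borel_measurable borel" "Y \<in> borel_measurable borel"
    and p: "\<And>u. 0 \<le> p u" "(\<integral>\<^sup>+u. ennreal (p u) \<partial>lborel) = 1"
    and r: "\<And>u. 0 < r u" "\<And>u. r u \<le> C" "(\<integral>\<^sup>+u. ennreal (r u) \<partial>lborel) = 1"
    and Y: "\<And>u. 0 \<le> Y u"
    and plnp: "integrable lborel (\<lambda>u. p u * ln (p u))"
    and int: "integrable lborel (\<lambda>u. p u * (c - ln (r u) + Y u))"
  defines "e \<equiv> (\<integral>u. p u * ln (p u) \<partial>lborel)"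
  shows "0 \<le> (\<integral>u. p u * (c - ln (r u) + Y u) \<partial>lborel) - c + e"
    and "(\<integral>u. p u * (c - ln (r u) + Y u) \<partial>lborel) - c + e = 0 \<Longrightarrow> (AE u in lborel. p u = r u) \<and> (AE u in lborel. p u * Y u = 0)"
proof -
  have ip: "integrable lborel p" "(\<integral>u. p u \<partial>lborel) = 1"
    using p by (auto intro!: integrableI_nonneg simp: integral_eq_nn_integral)
  have ir: "integrable lborel r" "(\<integral>u. r u \<partial>lborel) = 1"
    using r by (auto intro!: integrableI_nonneg simp: integral_eq_nn_integral less_imp_le)
  have ln_le: "ln (r u) \<le> ln C" for u using r(1,2)[of u] by simp
  have "integrable lborel (\<lambda>u. p u * (c - ln (r u) + Y u) + (ln C - c) * p u)"
    by (intro Bochner_Integration.integrable_add int integrable_mult_right ip)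
  then have sum: "integrable lborel (\<lambda>u. p u * (ln C - ln (r u)) + p u * Y u)"
    by (simp add: algebra_simps)
  have i1: "integrable lborel (\<lambda>u. p u * (ln C - ln (r u)))"
    by (rule Bochner_Integration.integrable_bound[OF sum]) (use p Y ln_le in \<open>auto simp: abs_mult\<close>)
  have iY: "integrable lborel (\<lambda>u. p u * Y u)"
    by (rule Bochner_Integration.integrable_bound[OF sum]) (use p Y ln_le in \<open>auto simp: abs_mult\<close>)
  have "integrable lborel (\<lambda>u. ln C * p u - p u * (ln C - ln (r u)))"
    by (intro Bochner_Integration.integrable_diff i1 integrable_mult_right ip)
  then have plnr: "integrable lborel (\<lambda>u. p u * ln (r u))" by (simp add: algebra_simps)
  let ?g = "\<lambda>u. (p u * ln (p u) - p u * ln (r u) - (p u - r u)) + p u * Y u"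
  have g0: "0 \<le> ?g u" for u
    using gibbs_pointwise(1)[OF p(1)[of u] r(1)[of u]] p(1)[of u] Y[of u] by simp
  have ig: "integrable lborel ?g"
    by (intro Bochner_Integration.integrable_add Bochner_Integration.integrable_diff plnp plnr ip ir iY)
  have "(\<integral>u. ?g u \<partial>lborel) = e - (\<integral>u. p u * ln (r u) \<partial>lborel) + (\<integral>u. p u * Y u \<partial>lborel)"
    using plnp plnr ip ir iY by (simp add: e_def)
  moreover have "(\<integral>u. p u * (c - ln (r u) + Y u) \<partial>lborel)
      = c - (\<integral>u. p u * ln (r u) \<partial>lborel) + (\<integral>u. p u * Y u \<partial>lborel)"
  proof -
    have "(\<lambda>u. p u * (c - ln (r u) + Y u)) = (\<lambda>u. c * p u - p u * ln (r u) + p u * Y u)"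
      by (simp add: algebra_simps)
    then show ?thesis using plnr ip iY by simp
  qed
  ultimately have eq: "(\<integral>u. p u * (c - ln (r u) + Y u) \<partial>lborel) - c + e = (\<integral>u. ?g u \<partial>lborel)"
    by simp
  show "0 \<le> (\<integral>u. p u * (c - ln (r u) + Y u) \<partial>lborel) - c + e"
    unfolding eq by (intro integral_nonneg_AE AE_I2 g0)
  assume "(\<integral>u. p u * (c - ln (r u) + Y u) \<partial>lborel) - c + e = 0"
  then have "AE u in lborel. ?g u = 0"
    unfolding eq using integral_nonneg_eq_0_iff_AE[OF ig] g0 by auto
  then have "AE u in lborel. p u = r u \<and> p u * Y u = 0"
  proof eventually_elim
    case (elim u)
    have "0 \<le> p u * Y u" using p(1)[of u] Y[of u] by simp
    then have "p u * Y u = 0" "p u * ln (p u) - p u * ln (r u) = p u - r u"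
      using elim gibbs_pointwise(1)[OF p(1)[of u] r(1)[of u]] by linarith+
    then show ?case using gibbs_pointwise(2)[OF p(1)[of u] r(1)[of u]] by blast
  qed
  then show "(AE u in lborel. p u = r u) \<and> (AE u in lborel. p u * Y u = 0)" by auto
qed

text \<open>
  The pathwise relative entropy of \<open>\<pi>\<close> with respect to \<open>r\<close>: given the history at time \<open>j\<close>, the mean of
  the \<open>j\<close>-th summand over the control is the Kullback-Leibler divergence of \<open>\<pi> j h\<close> from \<open>r j h\<close>. The
  sampled control enters the logarithm of \<open>r\<close>, whereas the entropy of \<open>\<pi>\<close> enters only through its value,
  as in the cost of a path.
\<close>
definition excess :: "('n::finite, 'm::finite) policy \<Rightarrow> ('n, 'm) policy \<Rightarrow> nat \<Rightarrow> ('n, 'm) history \<Rightarrow> real" where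
  "excess r \<pi> k h = (\<Sum>j<k. - ln (r j (hist_at j h) (snd h j)) - diff_entropy (\<pi> j (hist_at j h)))"

lemma excess_extend:
  "h \<in> space (hist_space k) \<Longrightarrow>
    excess r \<pi> (Suc k) (extend_hist A B k h u) = excess r \<pi> k h - ln (r k h u) - diff_entropy (\<pi> k h)"
  by (simp add: excess_def hist_at_extend hist_at_same)

lemma diff_entropy_measurable:
  assumes "is_policy N \<pi>" "k < N"
  shows "(\<lambda>h. diff_entropy (\<pi> k h)) \<in> borel_measurable (hist_space k)"
proof -
  have [measurable]: "(\<lambda>(h, u). \<pi> k h u) \<in> borel_measurable (hist_space k \<Otimes>\<^sub>M lborel)"
    using assms by (simp add: is_policy_def cong: measurable_cong_sets)
  show ?thesis unfolding diff_entropy_def by measurable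
qed

lemma excess_measurable:
  assumes r: "is_policy N r" and p: "is_policy N \<pi>" and "k \<le> N"
  shows "excess r \<pi> k \<in> borel_measurable (hist_space k)"
  unfolding excess_def[abs_def]
proof (intro borel_measurable_sum borel_measurable_diff borel_measurable_uminus)
  fix j assume "j \<in> {..<k}"
  then have j: "j < k" "j < N" using \<open>k \<le> N\<close> by auto
  have [measurable]: "(\<lambda>(h, u). r j h u) \<in> borel_measurable (hist_space j \<Otimes>\<^sub>M borel)"
    using r j by (simp add: is_policy_def)
  have [measurable]: "hist_at j \<in> hist_space k \<rightarrow>\<^sub>M hist_space j" "(\<lambda>h. snd h j) \<in> borel_measurable (hist_space k)"
    using j by auto
  show "(\<lambda>h. ln (r j (hist_at j h) (snd h j))) \<in> borel_measurable (hist_space k)"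
    by measurable
  show "(\<lambda>h. diff_entropy (\<pi> j (hist_at j h))) \<in> borel_measurable (hist_space k)"
    by (rule measurable_compose[OF _ diff_entropy_measurable[OF p j(2)]]) measurable
qed

context controlled_process
begin

lemma pair_sigma_finite_law: "k \<le> N \<Longrightarrow> pair_sigma_finite (law k) (lborel :: (real^'m) measure)"
  using prob_space_law[of k]
  by (intro pair_sigma_finite.intro) (auto intro: prob_space_imp_sigma_finite sigma_finite_lborel)

lemma extend_hist_measurable_lborel:
  "(\<lambda>(h, u). extend_hist A B k h u) \<in> hist_space k \<Otimes>\<^sub>M lborel \<rightarrow>\<^sub>M hist_space (Suc k)"
  using extend_hist_measurable by (simp cong: measurable_cong_sets)

lemma law_Suc_integrable_iff:
  fixes f :: "('n, 'm) history \<Rightarrow> real"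
  assumes k: "k < N" and f[measurable]: "f \<in> borel_measurable (hist_space (Suc k))"
  shows "integrable (law (Suc k)) f \<longleftrightarrow>
    integrable (law k \<Otimes>\<^sub>M lborel) (\<lambda>(h, u). \<pi> k h u * f (extend_hist A B k h u))"
    and "(\<integral>h. f h \<partial>law (Suc k)) = (\<integral>z. (case z of (h, u) \<Rightarrow> \<pi> k h u * f (extend_hist A B k h u)) \<partial>(law k \<Otimes>\<^sub>M lborel))"
proof -
  have [measurable_cong]: "sets (law k) = sets (hist_space k)" by (rule sets_law[OF less_imp_le[OF k]])
  note [measurable] = policy_measurable[OF k] extend_hist_measurable_lborel
  have nn: "AE z in law k \<Otimes>\<^sub>M lborel. 0 \<le> (case z of (h, u) \<Rightarrow> \<pi> k h u)"
    using policy_nonneg[OF k] space_law[of k] k by (auto simp: space_pair_measure intro!: AE_I2)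
  have d: "(\<lambda>(h, u). ennreal (\<pi> k h u)) = (\<lambda>z. ennreal (case z of (h, u) \<Rightarrow> \<pi> k h u))" by auto
  show "integrable (law (Suc k)) f \<longleftrightarrow>
    integrable (law k \<Otimes>\<^sub>M lborel) (\<lambda>(h, u). \<pi> k h u * f (extend_hist A B k h u))"
    unfolding law_Suc_eq_distr[OF k] d
    by (subst integrable_distr_eq, measurable, subst integrable_density)
      (use nn in \<open>auto simp: split_beta'\<close>)
  show "(\<integral>h. f h \<partial>law (Suc k)) = (\<integral>z. (case z of (h, u) \<Rightarrow> \<pi> k h u * f (extend_hist A B k h u)) \<partial>(law k \<Otimes>\<^sub>M lborel))"
    unfolding law_Suc_eq_distr[OF k] d
    by (subst integral_distr, measurable, subst integral_density)
      (use nn in \<open>auto simp: split_beta'\<close>)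
qed

lemma law_Suc_integral:
  fixes f :: "('n, 'm) history \<Rightarrow> real"
  assumes k: "k < N" and f: "f \<in> borel_measurable (hist_space (Suc k))" and int: "integrable (law (Suc k)) f"
  shows "AE h in law k. integrable lborel (\<lambda>u. \<pi> k h u * f (extend_hist A B k h u))"
    and "integrable (law k) (\<lambda>h. \<integral>u. \<pi> k h u * f (extend_hist A B k h u) \<partial>lborel)"
    and "(\<integral>h. f h \<partial>law (Suc k)) = (\<integral>h. \<integral>u. \<pi> k h u * f (extend_hist A B k h u) \<partial>lborel \<partial>law k)"
proof -
  interpret pair_sigma_finite "law k" "lborel :: (real^'m) measure"
    using pair_sigma_finite_law k by simp
  have i: "integrable (law k \<Otimes>\<^sub>M lborel) (\<lambda>(h, u). \<pi> k h u * f (extend_hist A B k h u))"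
    using int law_Suc_integrable_iff(1)[OF k f] by simp
  show "AE h in law k. integrable lborel (\<lambda>u. \<pi> k h u * f (extend_hist A B k h u))"
    using AE_integrable_fst'[OF i] by simp
  show "integrable (law k) (\<lambda>h. \<integral>u. \<pi> k h u * f (extend_hist A B k h u) \<partial>lborel)"
    using integrable_fst'[OF i] by simp
  show "(\<integral>h. f h \<partial>law (Suc k)) = (\<integral>h. \<integral>u. \<pi> k h u * f (extend_hist A B k h u) \<partial>lborel \<partial>law k)"
    using integral_fst'[OF i] law_Suc_integrable_iff(2)[OF k f] by simp
qed

text \<open>
  The expected excess is nonnegative and vanishes only for the reference policy. The difficulty is that
  only the whole sum is known to be integrable, not its summands, so that the expectation cannot be
  distributed over them. The induction therefore integrates out one control at a time, starting from the
  last. What has been integrated out is a sum of divergences; it is a nonnegative function \<open>Y\<close> of the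
  earlier history, and the statement is generalised over such \<open>Y\<close>. Taking \<open>Y = 0\<close> gives the
  claim about the excess.
\<close>
theorem sequential_gibbs:
  assumes r: "is_policy N r" "\<And>k h u. k < N \<Longrightarrow> 0 < r k h u" "\<And>k h u. k < N \<Longrightarrow> r k h u \<le> C k"
    and ent: "\<And>k. k < N \<Longrightarrow> AE h in law k. integrable lborel (\<lambda>u. \<pi> k h u * ln (\<pi> k h u))"
  shows "k \<le> N \<Longrightarrow> Y \<in> borel_measurable (hist_space k) \<Longrightarrow> (\<And>h. 0 \<le> Y h) \<Longrightarrow>
    integrable (law k) (\<lambda>h. excess r \<pi> k h + Y h) \<Longrightarrow>
    0 \<le> (\<integral>h. excess r \<pi> k h + Y h \<partial>law k) \<and>
    ((\<integral>h. excess r \<pi> k h + Y h \<partial>law k) = 0 \<longrightarrow>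
      (AE h in law k. Y h = 0) \<and> (\<forall>j<k. AE h in law j. AE u in lborel. \<pi> j h u = r j h u))"
proof (induction k arbitrary: Y)
  case 0
  then have i: "integrable (law 0) Y" by (simp add: excess_def del: hist_law.simps)
  then show ?case
    using 0 integral_nonneg_eq_0_iff_AE[OF i] by (auto simp: excess_def simp del: hist_law.simps)
next
  case (Suc k)
  then have k: "k < N" by simp
  note [measurable] = \<open>Y \<in> _\<close>
  let ?ext = "extend_hist A B k"
  define f where "f h = excess r \<pi> (Suc k) h + Y h" for h
  (* J is the divergence of the last decision plus the conditional mean of Y given h. *)
  define J where "J h = (\<integral>u. \<pi> k h u * f (?ext h u) \<partial>lborel) - excess r \<pi> k h" for h
  have mf: "f \<in> borel_measurable (hist_space (Suc k))"
    unfolding f_def[abs_def] using excess_measurable[OF r(1) policy Suc.prems(1)] by measurable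
  have if': "integrable (law (Suc k)) f" using Suc.prems(4) unfolding f_def[abs_def] .
  note step = law_Suc_integral[OF k mf if']
  have cond: "AE h in law k. 0 \<le> J h \<and>
    (J h = 0 \<longrightarrow> (AE u in lborel. \<pi> k h u = r k h u) \<and> (AE u in lborel. \<pi> k h u * Y (?ext h u) = 0))"
    using step(1) ent[OF k] AE_space
  proof eventually_elim
    case (elim h)
    then have h: "h \<in> space (hist_space k)" using space_law k by simp
    have [measurable]: "?ext h \<in> borel \<rightarrow>\<^sub>M hist_space (Suc k)"
      using measurable_Pair2[OF extend_hist_measurable h, of A B] by simp
    let ?c = "excess r \<pi> k h - diff_entropy (\<pi> k h)"
    have f_ext: "f (?ext h u) = ?c - ln (r k h u) + Y (?ext h u)" for u
      by (simp add: f_def excess_extend[OF h])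
    have mr: "r k h \<in> borel_measurable borel"
      using r(1) k measurable_Pair2[OF _ h, of "\<lambda>(h, u). r k h u"] by (simp add: is_policy_def)
    have nr: "(\<integral>\<^sup>+u. ennreal (r k h u) \<partial>lborel) = 1" using r(1) k h by (simp add: is_policy_def)
    have mY: "(\<lambda>u. Y (?ext h u)) \<in> borel_measurable borel" by measurable
    have J: "J h = (\<integral>u. \<pi> k h u * (?c - ln (r k h u) + Y (?ext h u)) \<partial>lborel) - ?c + (\<integral>u. \<pi> k h u * ln (\<pi> k h u) \<partial>lborel)"
      by (simp add: J_def f_ext diff_entropy_def)
    note G = gibbs_conditional[OF policy_section_measurable[OF k h] mr mY policy_nonneg[OF k h]
        policy_nn_integral[OF k h] r(2)[OF k] r(3)[OF k] nr Suc.prems(3) elim(2) elim(1)[unfolded f_ext]]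
    show ?case unfolding J using G by blast
  qed
  (* J is nonnegative only almost everywhere; the induction hypothesis wants a function that is
     nonnegative everywhere. *)
  define Y' where "Y' h = max 0 (J h)" for h
  have [measurable_cong]: "sets (law k) = sets (hist_space k)" by (rule sets_law[OF less_imp_le[OF k]])
  have mJ: "J \<in> borel_measurable (hist_space k)"
  proof -
    note [measurable] = policy_measurable[OF k] extend_hist_measurable_lborel mf
    show ?thesis
      unfolding J_def[abs_def] using excess_measurable[OF r(1) policy less_imp_le[OF k]] by measurable
  qed
  have eq: "AE h in law k. excess r \<pi> k h + Y' h = (\<integral>u. \<pi> k h u * f (?ext h u) \<partial>lborel)"
    using cond by eventually_elim (simp add: Y'_def J_def)
  have m: "(\<lambda>h. excess r \<pi> k h + Y' h) \<in> borel_measurable (law k)"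
    unfolding Y'_def[abs_def] using excess_measurable[OF r(1) policy less_imp_le[OF k]] mJ by measurable
  have i': "integrable (law k) (\<lambda>h. excess r \<pi> k h + Y' h)"
    using step(2) eq m integrable_cong_AE[OF m _ eq] by auto
  have int_eq: "(\<integral>h. excess r \<pi> k h + Y' h \<partial>law k) = (\<integral>h. f h \<partial>law (Suc k))"
    unfolding step(3) by (rule integral_cong_AE[OF m _ eq]) (use step(2) in auto)
  have IH: "0 \<le> (\<integral>h. excess r \<pi> k h + Y' h \<partial>law k) \<and>
    ((\<integral>h. excess r \<pi> k h + Y' h \<partial>law k) = 0 \<longrightarrow>
      (AE h in law k. Y' h = 0) \<and> (\<forall>j<k. AE h in law j. AE u in lborel. \<pi> j h u = r j h u))"
    by (rule Suc.IH) (use k mJ i' in \<open>auto simp: Y'_def[abs_def]\<close>)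
  show ?case
  proof (intro conjI impI)
    show "0 \<le> (\<integral>h. excess r \<pi> (Suc k) h + Y h \<partial>law (Suc k))"
      using IH int_eq by (simp add: f_def del: hist_law.simps)
  next
    assume "(\<integral>h. excess r \<pi> (Suc k) h + Y h \<partial>law (Suc k)) = 0"
    then have Y': "AE h in law k. Y' h = 0" and past: "\<forall>j<k. AE h in law j. AE u in lborel. \<pi> j h u = r j h u"
      using IH int_eq by (auto simp: f_def simp del: hist_law.simps)
    have both: "AE h in law k. (AE u in lborel. \<pi> k h u = r k h u) \<and> (AE u in lborel. \<pi> k h u * Y (?ext h u) = 0)"
      using cond Y' by eventually_elim (simp add: Y'_def max_def split: if_splits)
    show "\<forall>j<Suc k. AE h in law j. AE u in lborel. \<pi> j h u = r j h u"
      using past both by (auto simp: less_Suc_eq simp del: hist_law.simps)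
    have "(\<integral>\<^sup>+h. ennreal (Y h) \<partial>law (Suc k)) = (\<integral>\<^sup>+h. \<integral>\<^sup>+u. ennreal (\<pi> k h u) * ennreal (Y (?ext h u)) \<partial>lborel \<partial>law k)"
      by (rule law_Suc_nn_integral[OF k]) measurable
    also have "\<dots> = (\<integral>\<^sup>+h. 0 \<partial>law k)"
    proof (rule nn_integral_cong_AE)
      show "AE h in law k. (\<integral>\<^sup>+u. ennreal (\<pi> k h u) * ennreal (Y (?ext h u)) \<partial>lborel) = 0"
        using both AE_space
      proof eventually_elim
        case (elim h)
        then have h: "h \<in> space (hist_space k)" using space_law k by simp
        have "(\<integral>\<^sup>+u. ennreal (\<pi> k h u) * ennreal (Y (?ext h u)) \<partial>lborel) = (\<integral>\<^sup>+(u::real^'m). 0 \<partial>lborel)"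
          by (rule nn_integral_cong_AE)
            (use elim(1) Suc.prems(3) policy_nonneg[OF k h] in \<open>auto simp: ennreal_mult[symmetric]\<close>)
        then show ?case by simp
      qed
    qed
    finally have "(\<integral>\<^sup>+h. ennreal (Y h) \<partial>law (Suc k)) = 0" by simp
    moreover have "Y \<in> borel_measurable (law (Suc k))"
      using Suc.prems(2) sets_law[OF Suc.prems(1)] by (simp cong: measurable_cong_sets)
    ultimately have "AE h in law (Suc k). ennreal (Y h) = 0"
      by (subst (asm) nn_integral_0_iff_AE) auto
    then show "AE h in law (Suc k). Y h = 0"
      by eventually_elim (use Suc.prems(3) in \<open>simp add: ennreal_eq_0_iff order.antisym\<close>)
  qed
qed

end

section \<open>Boundary laws and dynamics of a controlled process\<close>

lemma distributed_lborelI: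
  fixes X :: "'b \<Rightarrow> 'a::euclidean_space"
  assumes [measurable]: "X \<in> borel_measurable M" "f \<in> borel_measurable borel"
    and eq: "\<And>g. g \<in> borel_measurable borel \<Longrightarrow> (\<integral>\<^sup>+x. g (X x) \<partial>M) = (\<integral>\<^sup>+y. f y * g y \<partial>lborel)"
  shows "distributed M lborel X f"
  unfolding distributed_def
proof (intro conjI measure_eqI)
  fix Z assume "Z \<in> sets (distr M lborel X)"
  then have [measurable]: "Z \<in> sets borel" by simp
  have "emeasure (distr M lborel X) Z = (\<integral>\<^sup>+x. indicator Z (X x) \<partial>M)"
    by (subst nn_integral_distr[of X M lborel, symmetric]) auto
  also have "\<dots> = emeasure (density lborel f) Z"
    by (subst eq) (auto simp: emeasure_density)
  finally show "emeasure (distr M lborel X) Z = emeasure (density lborel f) Z" .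
qed auto

context controlled_process
begin

lemma initial_state_nn_integral:
  assumes f[measurable]: "f \<in> borel_measurable borel"
  shows "k \<le> N \<Longrightarrow> (\<integral>\<^sup>+h. f (fst h 0) \<partial>law k) = (\<integral>\<^sup>+x. ennreal (gaussian_density 0 V0 x) * f x \<partial>lborel)"
proof (induction k)
  case 0
  show ?case
    unfolding law_0 by (subst nn_integral_distr) (use initial_history_measurable in \<open>auto simp: nn_integral_density\<close>)
next
  case (Suc k)
  then have k: "k < N" by simp
  have "(\<integral>\<^sup>+h. f (fst h 0) \<partial>law (Suc k)) = (\<integral>\<^sup>+h. \<integral>\<^sup>+u. ennreal (\<pi> k h u) * f (fst h 0) \<partial>lborel \<partial>law k)"
    by (subst law_Suc_nn_integral[OF k]) simp_all
  also have "\<dots> = (\<integral>\<^sup>+h. f (fst h 0) \<partial>law k)"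
  proof (rule nn_integral_cong)
    fix h assume "h \<in> space (law k)"
    then have h: "h \<in> space (hist_space k)" using space_law k by simp
    show "(\<integral>\<^sup>+u. ennreal (\<pi> k h u) * f (fst h 0) \<partial>lborel) = f (fst h 0)"
      using policy_section_measurable[OF k h] by (subst nn_integral_multc) (auto simp: policy_nn_integral[OF k h])
  qed
  finally show ?case using Suc k by simp
qed

lemma initial_state_distributed:
  "k \<le> N \<Longrightarrow> distributed (law k) lborel (\<lambda>h. fst h 0) (\<lambda>x. ennreal (gaussian_density 0 V0 x))"
  by (rule distributed_lborelI[OF _ _ initial_state_nn_integral])
    (use hist_state_measurable[of 0 k] sets_law[of k] in \<open>auto cong: measurable_cong_sets\<close>)

text \<open>
  Histories are arbitrary families of states and controls; that they obey the dynamics is a property of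
  their law.
\<close>
lemma law_dynamics:
  "k \<le> N \<Longrightarrow> AE h in law k. \<forall>j<k. fst h (Suc j) = A j *v fst h j + B j *v snd h j"
proof (induction k)
  case (Suc k)
  then have k: "k < N" by simp
  let ?P = "\<lambda>k h. \<forall>j<k. fst h (Suc j) = A j *v fst h j + B j *v snd h j"
  have P[measurable]: "Measurable.pred (hist_space (Suc k)) (?P (Suc k))"
  proof -
    have "Measurable.pred (hist_space (Suc k)) (\<lambda>h. fst h (Suc j) = A j *v fst h j + B j *v snd h j)"
      if "j \<in> {..<Suc k}" for j
    proof -
      have [measurable]: "(\<lambda>h. fst h (Suc j)) \<in> borel_measurable (hist_space (Suc k))"
        "(\<lambda>h. A j *v fst h j + B j *v snd h j) \<in> borel_measurable (hist_space (Suc k))"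
        using that by (auto intro!: borel_measurable_add borel_measurable_matrix_vector_mult
            hist_state_measurable hist_control_measurable)
      show ?thesis unfolding pred_def by (rule measurable_equality_set) measurable
    qed
    then have "Measurable.pred (hist_space (Suc k)) (\<lambda>h. \<forall>j\<in>{..<Suc k}. fst h (Suc j) = A j *v fst h j + B j *v snd h j)"
      by (intro pred_intros_finite) auto
    then show ?thesis by (simp only: lessThan_iff Ball_def)
  qed
  have [measurable_cong]: "sets (law k) = sets (hist_space k)" by (rule sets_law[OF less_imp_le[OF k]])
  have "(AE h in law k. AE h' in step k h. ?P (Suc k) h')"
    using Suc.IH[OF less_imp_le[OF k]] AE_space
  proof eventually_elim
    case (elim h)
    then have h: "h \<in> space (hist_space k)" using space_law k by simp
    have [measurable]: "extend_hist A B k h \<in> borel \<rightarrow>\<^sub>M hist_space (Suc k)"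
      using measurable_Pair2[OF extend_hist_measurable h, of A B] by simp
    have dyn: "?P (Suc k) (extend_hist A B k h u)" for u
    proof (intro allI impI)
      fix j assume "j < Suc k"
      then consider "j = k" | "j < k" by linarith
      then show "fst (extend_hist A B k h u) (Suc j)
          = A j *v fst (extend_hist A B k h u) j + B j *v snd (extend_hist A B k h u) j"
      proof cases
        case 2
        then have "fst h (Suc j) = A j *v fst h j + B j *v snd h j" using elim(1) by blast
        with 2 show ?thesis by (simp only: extend_hist_simps Suc_leI less_imp_le)
      qed simp
    qed
    have set: "{h' \<in> space (hist_space (Suc k)). ?P (Suc k) h'} \<in> sets (hist_space (Suc k))"
      using P unfolding pred_def .
    have ext: "extend_hist A B k h \<in> density lborel (\<lambda>u. ennreal (\<pi> k h u)) \<rightarrow>\<^sub>M hist_space (Suc k)"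
      by simp
    show ?case
      unfolding step_def AE_distr_iff[OF ext set] by (rule AE_I2) (rule dyn)
  qed
  moreover have "step k \<in> law k \<rightarrow>\<^sub>M subprob_algebra (hist_space (Suc k))"
    using measurable_prob_algebraD[OF step_measurable[OF k]] by simp
  ultimately show ?case
    unfolding law_Suc using AE_bind[OF _ P] by blast
qed simp

text \<open>
  For the reference policy itself the conditional mean of each summand of the excess is zero. The uniform
  bound on the absolute entropy integrals is what makes the sum integrable over all histories.
\<close>
lemma excess_self:
  assumes ent: "\<And>k h. k < N \<Longrightarrow> h \<in> space (hist_space k) \<Longrightarrow> integrable lborel (\<lambda>u. \<pi> k h u * ln (\<pi> k h u))"
    and b: "\<And>k h. k < N \<Longrightarrow> h \<in> space (hist_space k) \<Longrightarrow> (\<integral>u. \<bar>\<pi> k h u * ln (\<pi> k h u)\<bar> \<partial>lborel) \<le> b k"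
  shows "k \<le> N \<Longrightarrow> integrable (law k) (excess \<pi> \<pi> k) \<and> (\<integral>h. excess \<pi> \<pi> k h \<partial>law k) = 0"
proof (induction k)
  case 0
  then show ?case by (simp add: excess_def del: hist_law.simps)
next
  case (Suc k)
  then have k: "k < N" by simp
  then have IH: "integrable (law k) (excess \<pi> \<pi> k)" "(\<integral>h. excess \<pi> \<pi> k h \<partial>law k) = 0" using Suc by auto
  interpret pair_sigma_finite "law k" "lborel :: (real^'m) measure"
    using pair_sigma_finite_law k by simp
  interpret prob_space "law k" using prob_space_law k by simp
  have [measurable_cong]: "sets (law k) = sets (hist_space k)" by (rule sets_law[OF less_imp_le[OF k]])
  note me = excess_measurable[OF policy policy Suc.prems]
  note [measurable] = policy_measurable[OF k] extend_hist_measurable_lborel me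
    excess_measurable[OF policy policy less_imp_le[OF k]] diff_entropy_measurable[OF policy k]
  let ?f = "\<lambda>h u. \<pi> k h u * excess \<pi> \<pi> (Suc k) (extend_hist A B k h u)"
  have sect: "integrable lborel (?f h)" "(\<integral>u. ?f h u \<partial>lborel) = excess \<pi> \<pi> k h"
    "(\<integral>u. \<bar>?f h u\<bar> \<partial>lborel) \<le> \<bar>excess \<pi> \<pi> k h\<bar> + 2 * b k" if h: "h \<in> space (hist_space k)" for h
  proof -
    have ip: "integrable lborel (\<pi> k h)" "(\<integral>u. \<pi> k h u \<partial>lborel) = 1"
      using policy_nonneg[OF k h] policy_nn_integral[OF k h] policy_section_measurable[OF k h]
      by (auto intro!: integrableI_nonneg simp: integral_eq_nn_integral)
    let ?c = "excess \<pi> \<pi> k h - diff_entropy (\<pi> k h)"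
    have f: "?f h = (\<lambda>u. ?c * \<pi> k h u - \<pi> k h u * ln (\<pi> k h u))"
      by (simp add: excess_extend[OF h] algebra_simps)
    show i: "integrable lborel (?f h)" unfolding f using ip ent[OF k h] by simp
    show "(\<integral>u. ?f h u \<partial>lborel) = excess \<pi> \<pi> k h"
      unfolding f using ip ent[OF k h] by (simp add: diff_entropy_def)
    have e: "\<bar>diff_entropy (\<pi> k h)\<bar> \<le> b k"
      using order_trans[OF integral_norm_bound[of lborel "\<lambda>u. \<pi> k h u * ln (\<pi> k h u)"], of "b k"] b[OF k h]
      by (simp add: diff_entropy_def)
    have "(\<integral>u. \<bar>?f h u\<bar> \<partial>lborel) \<le> (\<integral>u. \<bar>?c\<bar> * \<pi> k h u + \<bar>\<pi> k h u * ln (\<pi> k h u)\<bar> \<partial>lborel)"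
    proof (rule integral_mono)
      show "integrable lborel (\<lambda>u. \<bar>?f h u\<bar>)" using i by simp
      show "integrable lborel (\<lambda>u. \<bar>?c\<bar> * \<pi> k h u + \<bar>\<pi> k h u * ln (\<pi> k h u)\<bar>)"
        using ip ent[OF k h] by simp
      fix u
      have "\<bar>?c * \<pi> k h u\<bar> = \<bar>?c\<bar> * \<pi> k h u" using policy_nonneg[OF k h] by (simp add: abs_mult)
      then show "\<bar>?f h u\<bar> \<le> \<bar>?c\<bar> * \<pi> k h u + \<bar>\<pi> k h u * ln (\<pi> k h u)\<bar>"
        unfolding fun_cong[OF f] using abs_triangle_ineq4 by metis
    qed
    also have "\<dots> = \<bar>?c\<bar> + (\<integral>u. \<bar>\<pi> k h u * ln (\<pi> k h u)\<bar> \<partial>lborel)"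
      using ip ent[OF k h] by simp
    also have "\<dots> \<le> (\<bar>excess \<pi> \<pi> k h\<bar> + b k) + b k"
      using b[OF k h] e by (intro add_mono) auto
    finally show "(\<integral>u. \<bar>?f h u\<bar> \<partial>lborel) \<le> \<bar>excess \<pi> \<pi> k h\<bar> + 2 * b k" by simp
  qed
  have "integrable (law k \<Otimes>\<^sub>M lborel) (\<lambda>(h, u). ?f h u)"
  proof (rule Fubini_integrable)
    show "(\<lambda>(h, u). ?f h u) \<in> borel_measurable (law k \<Otimes>\<^sub>M lborel)" by measurable
    have "integrable (law k) (\<lambda>h. \<bar>excess \<pi> \<pi> k h\<bar> + 2 * b k)" using IH by simp
    then show "integrable (law k) (\<lambda>h. \<integral>u. norm (case (h, u) of (h, u) \<Rightarrow> ?f h u) \<partial>lborel)"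
    proof (rule Bochner_Integration.integrable_bound)
      show "AE h in law k. norm (\<integral>u. norm (case (h, u) of (h, u) \<Rightarrow> ?f h u) \<partial>lborel)
          \<le> norm (\<bar>excess \<pi> \<pi> k h\<bar> + 2 * b k)"
        using AE_space
      proof eventually_elim
        case (elim h)
        then have h: "h \<in> space (hist_space k)" using space_law k by simp
        show ?case using sect(3)[OF h] by simp
      qed
    qed measurable
    show "AE h in law k. integrable lborel (\<lambda>u. case (h, u) of (h, u) \<Rightarrow> ?f h u)"
      using AE_space by eventually_elim (use sect(1) space_law k in auto)
  qed
  then have int: "integrable (law (Suc k)) (excess \<pi> \<pi> (Suc k))"
    using law_Suc_integrable_iff(1)[OF k me] by simp
  moreover have "(\<integral>h. excess \<pi> \<pi> (Suc k) h \<partial>law (Suc k)) = (\<integral>h. excess \<pi> \<pi> k h \<partial>law k)"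
    unfolding law_Suc_integral(3)[OF k me int]
    by (rule Bochner_Integration.integral_cong) (use sect(2) space_law k in auto)
  ultimately show ?case using IH by (simp del: hist_law.simps)
qed

end

section \<open>The Riccati policy\<close>

locale riccati_control =
  fixes N :: nat and A Q P H :: "nat \<Rightarrow> real^'n^'n" and B S :: "nat \<Rightarrow> real^'m^'n" and V0 VN :: "real^'n^'n"
  assumes V0: "pos_def V0" and VN: "pos_def VN"
    and A_bar_invertible: "\<And>k. k < N \<Longrightarrow> invertible (A_bar A B S k)"
    and riccati_P: "riccati_solution N (A_bar A B S) B (mat 1) (Q_bar Q S) P"
    and riccati_H: "riccati_solution N (A_bar A B S) B (- mat 1) (\<lambda>k. - Q_bar Q S k) H"
    and boundary_0: "matrix_inv V0 = P 0 + H 0"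
    and boundary_N: "matrix_inv VN = P N + H N"
    and control_weight_pos_def: "\<And>k. k < N \<Longrightarrow> pos_def (mat 1 + transpose (B k) ** P (Suc k) ** B k)"
begin

definition control_weight :: "nat \<Rightarrow> real^'m^'m" where "control_weight k = mat 1 + transpose (B k) ** P (Suc k) ** B k"
definition noise_cov :: "nat \<Rightarrow> real^'m^'m" where "noise_cov k = matrix_inv (control_weight k)"
definition gain :: "nat \<Rightarrow> real^'n^'m" where
  "gain k = noise_cov k ** (transpose (B k) ** P (Suc k) ** A k + transpose (S k))"
definition log_norm :: "nat \<Rightarrow> real" where "log_norm k = ln (sqrt ((2 * pi) ^ CARD('m) * det (noise_cov k)))"

abbreviation opt :: "('n, 'm) policy" where "opt \<equiv> riccati_policy A B S P"

lemma opt_eq: "opt k h = gaussian_density (- (gain k *v fst h k)) (noise_cov k)"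
  by (simp add: riccati_policy_def Let_def control_weight_def noise_cov_def gain_def)

lemma control_weight_invertible: "k < N \<Longrightarrow> invertible (control_weight k)"
  unfolding control_weight_def by (rule pos_def_invertible[OF control_weight_pos_def])

lemma noise_cov_pos_def: "k < N \<Longrightarrow> pos_def (noise_cov k)"
  unfolding noise_cov_def control_weight_def by (rule pos_def_matrix_inv[OF control_weight_pos_def])

lemma matrix_inv_noise_cov: "k < N \<Longrightarrow> matrix_inv (noise_cov k) = control_weight k"
  unfolding noise_cov_def by (rule matrix_inv_matrix_inv[OF control_weight_invertible])

lemma opt_pos: "k < N \<Longrightarrow> 0 < opt k h u"
  unfolding opt_eq by (rule gaussian_density_pos[OF noise_cov_pos_def])

lemma opt_le: "k < N \<Longrightarrow> opt k h u \<le> gaussian_density 0 (noise_cov k) 0"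
  unfolding opt_eq by (rule gaussian_density_le[OF noise_cov_pos_def])

lemma opt_is_policy: "is_policy N opt"
  unfolding is_policy_def
proof (intro allI impI conjI ballI)
  fix k assume k: "k < N"
  have [measurable]: "(\<lambda>h. fst h k) \<in> borel_measurable (hist_space k :: ('n,'m) history measure)" by simp
  have "(\<lambda>(h, u). gaussian_density 0 (noise_cov k) (u + gain k *v fst h k))
      \<in> borel_measurable ((hist_space k :: ('n,'m) history measure) \<Otimes>\<^sub>M borel)"
    by measurable
  then show "(\<lambda>(h, u). opt k h u) \<in> borel_measurable (hist_space k \<Otimes>\<^sub>M borel)"
    by (simp add: opt_eq[abs_def] gaussian_density_shift[of "- v" for v])
  show "0 \<le> opt k h u" for h u using opt_pos[OF k] less_imp_le by blast
  show "(\<integral>\<^sup>+u. ennreal (opt k h u) \<partial>lborel) = 1" for h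
    unfolding opt_eq by (rule nn_integral_gaussian_density[OF noise_cov_pos_def[OF k]])
qed

lemma P_symmetric: "k \<le> N \<Longrightarrow> symmetric_mat (P k)" and H_symmetric: "k \<le> N \<Longrightarrow> symmetric_mat (H k)"
  using riccati_P riccati_H by (auto simp: riccati_solution_def)

lemma P_step: "k < N \<Longrightarrow> P k = transpose (A_bar A B S k) ** P (Suc k) ** A_bar A B S k
    - transpose (A_bar A B S k) ** P (Suc k) ** B k ** noise_cov k ** transpose (B k) ** P (Suc k) ** A_bar A B S k
    + Q_bar Q S k"
  using riccati_P unfolding riccati_solution_def noise_cov_def control_weight_def by blast

lemma H_step: "k < N \<Longrightarrow> invertible (- mat 1 + transpose (B k) ** H (Suc k) ** B k) \<and>
    H k = transpose (A_bar A B S k) ** H (Suc k) ** A_bar A B S k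
    - transpose (A_bar A B S k) ** H (Suc k) ** B k ** matrix_inv (- mat 1 + transpose (B k) ** H (Suc k) ** B k)
      ** transpose (B k) ** H (Suc k) ** A_bar A B S k
    - Q_bar Q S k"
  using riccati_H unfolding riccati_solution_def by (metis (no_types, lifting) add_uminus_conv_diff)

text \<open>
  The squared deviation from the optimal mean is, up to the normalising constant, the negative logarithm
  of the optimal density.
\<close>
lemma stage_cost_opt:
  assumes k: "k < N"
  shows "stage_cost (Q k) (S k) (fst h k) u = fst h k \<bullet> (P k *v fst h k) / 2
    - (A k *v fst h k + B k *v u) \<bullet> (P (Suc k) *v (A k *v fst h k + B k *v u)) / 2 - ln (opt k h u) - log_norm k"
proof -
  let ?x = "fst h k"
  have "stage_cost (Q k) (S k) ?x u + (A k *v ?x + B k *v u) \<bullet> (P (Suc k) *v (A k *v ?x + B k *v u)) / 2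
    = ?x \<bullet> (P k *v ?x) / 2 + (u + gain k *v ?x) \<bullet> (control_weight k *v (u + gain k *v ?x)) / 2"
    by (rule stage_cost_completion[OF P_symmetric control_weight_def control_weight_invertible[OF k] _ _ gain_def[unfolded noise_cov_def]])
      (use k P_step[OF k] in \<open>auto simp: A_bar_def Q_bar_def noise_cov_def\<close>)
  moreover have "ln (opt k h u) = - ((u + gain k *v ?x) \<bullet> (control_weight k *v (u + gain k *v ?x)) / 2) - log_norm k"
    by (simp add: opt_eq ln_gaussian_density[OF noise_cov_pos_def[OF k]] matrix_inv_noise_cov[OF k] log_norm_def)
  ultimately show ?thesis by simp
qed

text \<open>
  The quadratic value functions telescope along a trajectory.
\<close>
lemma path_cost_eq_excess:
  assumes dyn: "\<And>j. j < N \<Longrightarrow> fst h (Suc j) = A j *v fst h j + B j *v snd h j"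
  shows "path_cost N Q S \<pi> h = fst h 0 \<bullet> (P 0 *v fst h 0) / 2 - fst h N \<bullet> (P N *v fst h N) / 2
    - (\<Sum>k<N. log_norm k) + excess opt \<pi> N h"
proof -
  let ?V = "\<lambda>k. fst h k \<bullet> (P k *v fst h k) / 2"
  have "path_cost N Q S \<pi> h = (\<Sum>k<N. (?V k - ?V (Suc k)) - log_norm k
      + (- ln (opt k (hist_at k h) (snd h k)) - diff_entropy (\<pi> k (hist_at k h))))"
    unfolding path_cost_def
  proof (rule sum.cong[OF refl])
    fix k assume "k \<in> {..<N}"
    then have k: "k < N" by simp
    have "fst (hist_at k h) k = fst h k" by (simp add: hist_at_def)
    then show "stage_cost (Q k) (S k) (fst h k) (snd h k) - diff_entropy (\<pi> k (hist_at k h))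
      = (?V k - ?V (Suc k)) - log_norm k + (- ln (opt k (hist_at k h) (snd h k)) - diff_entropy (\<pi> k (hist_at k h)))"
      using stage_cost_opt[OF k, of "hist_at k h" "snd h k"] dyn[OF k] by simp
  qed
  also have "\<dots> = (\<Sum>k<N. ?V k - ?V (Suc k)) - (\<Sum>k<N. log_norm k) + excess opt \<pi> N h"
    by (simp add: excess_def sum.distrib sum_subtractf)
  also have "(\<Sum>k<N. ?V k - ?V (Suc k)) = ?V 0 - ?V N"
    by (rule sum_lessThan_telescope')
  finally show ?thesis .
qed

definition boundary_cost :: real where
  "boundary_cost = (\<integral>x. gaussian_density 0 V0 x * (x \<bullet> (P 0 *v x)) \<partial>lborel) / 2
    - (\<integral>x. gaussian_density 0 VN x * (x \<bullet> (P N *v x)) \<partial>lborel) / 2 - (\<Sum>k<N. log_norm k)"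

lemma path_cost_measurable:
  assumes "is_policy N \<pi>"
  shows "path_cost N Q S \<pi> \<in> borel_measurable (hist_space N)"
  unfolding path_cost_def[abs_def]
proof (intro borel_measurable_sum borel_measurable_diff)
  fix k assume "k \<in> {..<N}"
  then have k: "k < N" by simp
  have [measurable]: "(\<lambda>h. fst h k) \<in> borel_measurable (hist_space N :: ('n,'m) history measure)"
    "(\<lambda>h. snd h k) \<in> borel_measurable (hist_space N :: ('n,'m) history measure)"
    using k by auto
  show "(\<lambda>h. stage_cost (Q k) (S k) (fst h k) (snd h k)) \<in> borel_measurable (hist_space N)"
    unfolding stage_cost_def by measurable
  show "(\<lambda>h. diff_entropy (\<pi> k (hist_at k h))) \<in> borel_measurable (hist_space N)"
    by (rule measurable_compose[OF hist_at_measurable diff_entropy_measurable[OF assms k]]) (use k in simp)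
qed

text \<open>
  Both boundary marginals are prescribed, so all policies with the right terminal law share the same
  \<open>boundary_cost\<close>.
\<close>
lemma cost_eq_excess:
  assumes policy: "is_policy N \<pi>"
    and terminal: "distributed (hist_law A B V0 \<pi> N) lborel (\<lambda>h. fst h N) (\<lambda>x. ennreal (gaussian_density 0 VN x))"
  shows "integrable (hist_law A B V0 \<pi> N) (path_cost N Q S \<pi>) \<longleftrightarrow> integrable (hist_law A B V0 \<pi> N) (excess opt \<pi> N)"
    and "integrable (hist_law A B V0 \<pi> N) (excess opt \<pi> N) \<Longrightarrow>
      maxent_cost N A B Q S V0 \<pi> = boundary_cost + (\<integral>h. excess opt \<pi> N h \<partial>hist_law A B V0 \<pi> N)"
proof -
  interpret controlled_process N A B V0 \<pi> by unfold_locales (fact V0 policy)+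
  interpret prob_space "law N" by (rule prob_space_law) simp
  have [measurable_cong]: "sets (law N) = sets (hist_space N)" by (rule sets_law) simp
  note [measurable] = path_cost_measurable[OF policy] excess_measurable[OF opt_is_policy policy order_refl]
  have [measurable]: "(\<lambda>h. fst h 0) \<in> borel_measurable (hist_space N :: ('n,'m) history measure)"
    "(\<lambda>h. fst h N) \<in> borel_measurable (hist_space N :: ('n,'m) history measure)" by auto
  note initial = initial_state_distributed[OF order_refl]
  have q[measurable]: "(\<lambda>x. x \<bullet> (P k *v x)) \<in> borel_measurable lborel" for k by simp
  have i0: "integrable (law N) (\<lambda>h. fst h 0 \<bullet> (P 0 *v fst h 0))"
    using distributed_integrable[OF initial q] integrable_gaussian_quadratic[OF V0] gaussian_density_pos[OF V0]
    by (simp add: less_imp_le)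
  have iN: "integrable (law N) (\<lambda>h. fst h N \<bullet> (P N *v fst h N))"
    using distributed_integrable[OF terminal q] integrable_gaussian_quadratic[OF VN] gaussian_density_pos[OF VN]
    by (simp add: less_imp_le)
  have e0: "(\<integral>h. fst h 0 \<bullet> (P 0 *v fst h 0) \<partial>law N) = (\<integral>x. gaussian_density 0 V0 x * (x \<bullet> (P 0 *v x)) \<partial>lborel)"
    using distributed_integral[OF initial q] gaussian_density_pos[OF V0] by (simp add: less_imp_le)
  have eN: "(\<integral>h. fst h N \<bullet> (P N *v fst h N) \<partial>law N) = (\<integral>x. gaussian_density 0 VN x * (x \<bullet> (P N *v x)) \<partial>lborel)"
    using distributed_integral[OF terminal q] gaussian_density_pos[OF VN] by (simp add: less_imp_le)
  let ?b = "\<lambda>h. fst h 0 \<bullet> (P 0 *v fst h 0) / 2 - fst h N \<bullet> (P N *v fst h N) / 2 - (\<Sum>k<N. log_norm k)"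
  have ib: "integrable (law N) ?b" using i0 iN by simp
  have eb: "(\<integral>h. ?b h \<partial>law N) = boundary_cost"
    using i0 iN by (simp add: e0 eN boundary_cost_def prob_space)
  have eq: "AE h in law N. path_cost N Q S \<pi> h = ?b h + excess opt \<pi> N h"
    using law_dynamics[OF order_refl] by eventually_elim (simp add: path_cost_eq_excess)
  have *: "integrable (law N) (path_cost N Q S \<pi>) \<longleftrightarrow> integrable (law N) (\<lambda>h. ?b h + excess opt \<pi> N h)"
    by (rule integrable_cong_AE[OF _ _ eq]) measurable
  show "integrable (law N) (path_cost N Q S \<pi>) \<longleftrightarrow> integrable (law N) (excess opt \<pi> N)"
  proof
    assume "integrable (law N) (path_cost N Q S \<pi>)"
    then have "integrable (law N) (\<lambda>h. (?b h + excess opt \<pi> N h) - ?b h)"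
      using ib * Bochner_Integration.integrable_diff by blast
    then show "integrable (law N) (excess opt \<pi> N)" by simp
  next
    assume "integrable (law N) (excess opt \<pi> N)"
    then show "integrable (law N) (path_cost N Q S \<pi>)"
      using ib * Bochner_Integration.integrable_add by blast
  qed
  assume ie: "integrable (law N) (excess opt \<pi> N)"
  have "maxent_cost N A B Q S V0 \<pi> = (\<integral>h. ?b h + excess opt \<pi> N h \<partial>law N)"
    unfolding maxent_cost_def by (rule integral_cong_AE[OF _ _ eq]) measurable
  also have "\<dots> = (\<integral>h. ?b h \<partial>law N) + (\<integral>h. excess opt \<pi> N h \<partial>law N)"
    by (rule Bochner_Integration.integral_add[OF ib ie])
  finally show "maxent_cost N A B Q S V0 \<pi> = boundary_cost + (\<integral>h. excess opt \<pi> N h \<partial>law N)"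
    unfolding eb .
qed

sublocale opt: controlled_process N A B V0 opt
  by unfold_locales (fact V0 opt_is_policy)+

text \<open>
  The state under the Riccati policy is a centred Gaussian with covariance \<open>(P k + H k)\<^sup>-\<^sup>1\<close> at every
  time. At time \<open>0\<close> this is the initial boundary condition, at time \<open>N\<close> it will give the terminal one.
\<close>
lemma opt_state_law:
  "k \<le> N \<Longrightarrow> \<exists>V. pos_def V \<and> V ** (P k + H k) = mat 1 \<and>
    (\<forall>f\<in>borel_measurable borel. (\<integral>\<^sup>+h. f (fst h k) \<partial>opt.law k) = (\<integral>\<^sup>+x. ennreal (gaussian_density 0 V x) * f x \<partial>lborel))"
proof (induction k)
  case 0
  have "V0 ** (P 0 + H 0) = mat 1"
    using matrix_inv_inverse(1)[OF pos_def_invertible[OF V0]] by (simp add: boundary_0)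
  then show ?case using V0 opt.initial_state_nn_integral[of _ 0] by blast
next
  case (Suc k)
  then have k: "k < N" by simp
  obtain V where V: "pos_def V" "V ** (P k + H k) = mat 1"
    and IH: "\<And>f. f \<in> borel_measurable borel \<Longrightarrow>
      (\<integral>\<^sup>+h. f (fst h k) \<partial>opt.law k) = (\<integral>\<^sup>+x. ennreal (gaussian_density 0 V x) * f x \<partial>lborel)"
    using Suc by auto
  let ?C = "A k - B k ** gain k"
  let ?V' = "?C ** V ** transpose ?C + B k ** noise_cov k ** transpose (B k)"
  note clc = closed_loop_covariance[OF P_symmetric H_symmetric A_bar_def A_bar_invertible[OF k]
      control_weight_invertible[OF k, unfolded control_weight_def]
      noise_cov_def[of k, unfolded control_weight_def]
      conjunct1[OF H_step[OF k]] refl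
      P_step[OF k] conjunct2[OF H_step[OF k]] V(2) refl]
  have C: "invertible ?C" and V'P: "?V' ** (P (Suc k) + H (Suc k)) = mat 1"
    using clc k by (simp_all add: gain_def)
  have V': "pos_def ?V'" by (rule pos_def_affine_covariance[OF V(1) noise_cov_pos_def[OF k] C])
  have "(\<integral>\<^sup>+h. f (fst h (Suc k)) \<partial>opt.law (Suc k)) = (\<integral>\<^sup>+x. ennreal (gaussian_density 0 ?V' x) * f x \<partial>lborel)"
    if f[measurable]: "f \<in> borel_measurable borel" for f
  proof -
    have "(\<integral>\<^sup>+h. f (fst h (Suc k)) \<partial>opt.law (Suc k))
      = (\<integral>\<^sup>+h. \<integral>\<^sup>+u. ennreal (opt k h u) * f (A k *v fst h k + B k *v u) \<partial>lborel \<partial>opt.law k)"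
      by (subst opt.law_Suc_nn_integral[OF k]) simp_all
    also have "\<dots> = (\<integral>\<^sup>+h. \<integral>\<^sup>+w. ennreal (gaussian_density 0 (noise_cov k) w) * f (?C *v fst h k + B k *v w) \<partial>lborel \<partial>opt.law k)"
    proof (rule nn_integral_cong)
      fix h :: "('n, 'm) history"
      let ?x = "fst h k"
      have "ennreal (opt k h u) * f (A k *v ?x + B k *v u)
          = (\<lambda>w. ennreal (gaussian_density 0 (noise_cov k) w) * f (?C *v ?x + B k *v w)) (u + gain k *v ?x)" for u
      proof -
        have "?C *v ?x + B k *v (u + gain k *v ?x) = A k *v ?x + B k *v u"
          by (simp add: matrix_vector_mult_diff_rdistrib matrix_vector_right_distrib matrix_vector_mul_assoc[symmetric])
        then show ?thesis by (simp add: opt_eq gaussian_density_shift[of "- v" for v])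
      qed
      then show "(\<integral>\<^sup>+u. ennreal (opt k h u) * f (A k *v ?x + B k *v u) \<partial>lborel)
          = (\<integral>\<^sup>+w. ennreal (gaussian_density 0 (noise_cov k) w) * f (?C *v ?x + B k *v w) \<partial>lborel)"
        by (simp only:) (rule nn_integral_lborel_translate, measurable)
    qed
    also have "\<dots> = (\<integral>\<^sup>+x. ennreal (gaussian_density 0 V x)
        * (\<integral>\<^sup>+w. ennreal (gaussian_density 0 (noise_cov k) w) * f (?C *v x + B k *v w) \<partial>lborel) \<partial>lborel)"
      by (rule IH) measurable
    also have "\<dots> = (\<integral>\<^sup>+x. ennreal (gaussian_density 0 ?V' x) * f x \<partial>lborel)"
      by (rule nn_integral_gaussian_affine[OF V(1) noise_cov_pos_def[OF k] C f])
    finally show ?thesis .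
  qed
  with V' V'P show ?case by blast
qed

lemma opt_terminal:
  "distributed (opt.law N) lborel (\<lambda>h. fst h N) (\<lambda>x. ennreal (gaussian_density 0 VN x))"
proof -
  obtain V where V: "V ** (P N + H N) = mat 1"
    and law: "\<And>f. f \<in> borel_measurable borel \<Longrightarrow>
      (\<integral>\<^sup>+h. f (fst h N) \<partial>opt.law N) = (\<integral>\<^sup>+x. ennreal (gaussian_density 0 V x) * f x \<partial>lborel)"
    using opt_state_law[OF order_refl] by auto
  have "V = VN"
    using V matrix_inv_inverse(2)[OF pos_def_invertible[OF VN]] unfolding boundary_N
    by (metis matrix_mul_assoc matrix_mul_lid matrix_mul_rid)
  then show ?thesis
    using law hist_state_measurable[OF order_refl, of N] opt.sets_law[OF order_refl]
    by (intro distributed_lborelI) (auto cong: measurable_cong_sets)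
qed

lemma opt_entropy_integrable: "k < N \<Longrightarrow> integrable lborel (\<lambda>u. opt k h u * ln (opt k h u))"
  unfolding opt_eq by (rule integrable_gaussian_entropy[OF noise_cov_pos_def])

text \<open>
  The control is its conditional mean plus a noise whose law is the same for every history, which gives
  the uniform bound on the entropy integrals.
\<close>
lemma opt_excess: "integrable (opt.law N) (excess opt opt N)" "(\<integral>h. excess opt opt N h \<partial>opt.law N) = 0"
proof -
  let ?g = "\<lambda>k u. \<bar>gaussian_density 0 (noise_cov k) u * ln (gaussian_density 0 (noise_cov k) u)\<bar>"
  have "(\<integral>u. \<bar>opt k h u * ln (opt k h u)\<bar> \<partial>lborel) \<le> (\<integral>u. ?g k u \<partial>lborel)" if k: "k < N" for k h
    using integral_lborel_translate[of "?g k" "gain k *v fst h k"]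
    by (simp add: opt_eq gaussian_density_shift[of "- v" for v])
  then show "integrable (opt.law N) (excess opt opt N)" "(\<integral>h. excess opt opt N h \<partial>opt.law N) = 0"
    using opt.excess_self[of "\<lambda>k. \<integral>u. ?g k u \<partial>lborel" N] opt_entropy_integrable by auto
qed

lemma opt_feasible: "maxent_feasible N A B Q S V0 VN opt"
  unfolding maxent_feasible_def
  using opt_is_policy opt_entropy_integrable opt_terminal opt_excess(1) cost_eq_excess(1)[OF opt_is_policy opt_terminal]
  by simp

lemma opt_cost: "maxent_cost N A B Q S V0 opt = boundary_cost"
  using cost_eq_excess(2)[OF opt_is_policy opt_terminal opt_excess(1)] opt_excess(2) by simp

lemma cost_lower_bound:
  assumes feas: "maxent_feasible N A B Q S V0 VN \<pi>"
  shows "boundary_cost \<le> maxent_cost N A B Q S V0 \<pi>"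
    and "maxent_cost N A B Q S V0 \<pi> = boundary_cost \<Longrightarrow> same_policy N A B V0 \<pi> opt"
proof -
  have policy: "is_policy N \<pi>"
    and ent: "\<And>k. k < N \<Longrightarrow> AE h in hist_law A B V0 \<pi> k. integrable lborel (\<lambda>u. \<pi> k h u * ln (\<pi> k h u))"
    and int: "integrable (hist_law A B V0 \<pi> N) (path_cost N Q S \<pi>)"
    and terminal: "distributed (hist_law A B V0 \<pi> N) lborel (\<lambda>h. fst h N) (\<lambda>x. ennreal (gaussian_density 0 VN x))"
    using feas by (auto simp: maxent_feasible_def)
  interpret controlled_process N A B V0 \<pi> by unfold_locales (fact V0 policy)+
  have ie: "integrable (law N) (excess opt \<pi> N)" using int cost_eq_excess(1)[OF policy terminal] by simp
  have cost: "maxent_cost N A B Q S V0 \<pi> = boundary_cost + (\<integral>h. excess opt \<pi> N h \<partial>law N)"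
    by (rule cost_eq_excess(2)[OF policy terminal ie])
  have gibbs: "0 \<le> (\<integral>h. excess opt \<pi> N h \<partial>law N) \<and>
    ((\<integral>h. excess opt \<pi> N h \<partial>law N) = 0 \<longrightarrow> (\<forall>j<N. AE h in law j. AE u in lborel. \<pi> j h u = opt j h u))"
    using sequential_gibbs[OF opt_is_policy opt_pos opt_le ent order_refl, of "\<lambda>_. 0"] ie by simp
  show "boundary_cost \<le> maxent_cost N A B Q S V0 \<pi>" using gibbs cost by simp
  assume "maxent_cost N A B Q S V0 \<pi> = boundary_cost"
  then show "same_policy N A B V0 \<pi> opt" using gibbs cost by (simp add: same_policy_def)
qed

end

theorem proposition3:
  fixes N :: nat
    and A Q P H :: "nat \<Rightarrow> real^'n^'n"
    and B S :: "nat \<Rightarrow> real^'m^'n"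
    and V0 VN :: "real^'n^'n"
  assumes "N \<ge> 1"
    and "\<And>k. k < N \<Longrightarrow> symmetric_mat (Q k)"
    and "\<And>k. k < N \<Longrightarrow> pos_semidef (Q_bar Q S k)"
    and "pos_def V0" and "pos_def VN"
    and "\<And>k. k < N \<Longrightarrow> invertible (A_bar A B S k)"
    and "riccati_solution N (A_bar A B S) B (mat 1) (Q_bar Q S) P"
    and "riccati_solution N (A_bar A B S) B (- mat 1) (\<lambda>k. - Q_bar Q S k) H"
    and "matrix_inv V0 = P 0 + H 0"
    and "matrix_inv VN = P N + H N"
    and "\<And>k. k < N \<Longrightarrow> pos_def (mat 1 + transpose (B k) ** P (Suc k) ** B k)"
  shows "maxent_optimal N A B Q S V0 VN (riccati_policy A B S P) \<and>
    (\<forall>\<pi>. maxent_optimal N A B Q S V0 VN \<pi> \<longrightarrow>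
       same_policy N A B V0 \<pi> (riccati_policy A B S P))"
proof -
  interpret riccati_control N A Q P H B S V0 VN
    by unfold_locales (use assms in auto)
  show ?thesis
    unfolding maxent_optimal_def using opt_feasible opt_cost cost_lower_bound by (metis antisym)
qed

end
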